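(* Let $m>n>0$ be integers. The morphism of complex algebraic varieties $$f:\mathbb{C}^{m\times n}\times\mathbb{C}^n\to\mathbb{C}^{m\times n}\times\mathbb{C}^{n+1},\qquad (A^*,\xi^* )\mapsto\bigl(A^*,\,p_1(A^*\xi^* ),\dots,p_{n+1}(A^*\xi^* )\bigr)$$ is a birational morphism onto its image $f(\mathbb{C}^{m\times n}\times\mathbb{C}^n)\subseteq\mathbb{C}^{m\times n}\times\mathbb{C}^{n+1}$.
   Context: For an integer $k\ge 1$, $p_k(y)=\sum_{i=1}^m y_i^k$ denotes the $k$-th power sum of the $m$ coordinates of $y=(y_1,\dots,y_m)$. Elements of $\mathbb{C}^{m\times n}$ are $m\times n$ complex matrices, and $A^*\xi^*\in\mathbb{C}^m$ is the matrix-vector product. "Birational onto its image" means that the induced dominant morphism from $\mathbb{C}^{m\times n}\times\mathbb{C}^n$ to the Zariski closure of the image (with reduced structure; an irreducible variety) is a birational morphism. *)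

theory Defs
  imports "HOL-Analysis.Abstract_Topology" "Jordan_Normal_Form.Matrix"
begin

text \<open>
  A complex affine space is a set of points together with its coordinate functions, which are
  meant to identify the points bijectively with $\mathbb{C}^I$ for a finite index set $I$. This
  allows points to be matrices, vectors, or pairs of these. Only the values of the
  coordinates on the points matter.
\<close>

record 'a affine_space =
  points :: "'a set"
  coords :: "('a \<Rightarrow> complex) set"

definition mat_affine :: "nat \<Rightarrow> nat \<Rightarrow> complex mat affine_space" where
  "mat_affine m n =
    \<lparr>points = carrier_mat m n, coords = {\<lambda>A. A $$ (i, j) | i j. i < m \<and> j < n}\<rparr>"

definition vec_affine :: "nat \<Rightarrow> complex vec affine_space" where
  "vec_affine n = \<lparr>points = carrier_vec n, coords = {\<lambda>v. v $ i | i. i < n}\<rparr>"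

definition prod_affine ::
    "'a affine_space \<Rightarrow> 'b affine_space \<Rightarrow> ('a \<times> 'b) affine_space" (infixr "\<times>\<^sub>A" 80) where
  "S \<times>\<^sub>A T =
    \<lparr>points = points S \<times> points T,
     coords = (\<lambda>c. c \<circ> fst) ` coords S \<union> (\<lambda>c. c \<circ> snd) ` coords T\<rparr>"

inductive_set poly_funs :: "'a affine_space \<Rightarrow> ('a \<Rightarrow> complex) set" for S :: "'a affine_space" where
  coord: "c \<in> coords S \<Longrightarrow> c \<in> poly_funs S"
| const: "(\<lambda>_. a) \<in> poly_funs S"
| add: "p \<in> poly_funs S \<Longrightarrow> q \<in> poly_funs S \<Longrightarrow> (\<lambda>x. p x + q x) \<in> poly_funs S"
| mult: "p \<in> poly_funs S \<Longrightarrow> q \<in> poly_funs S \<Longrightarrow> (\<lambda>x. p x * q x) \<in> poly_funs S"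

definition zero_locus :: "'a affine_space \<Rightarrow> ('a \<Rightarrow> complex) set \<Rightarrow> 'a set" where
  "zero_locus S F = {x \<in> points S. \<forall>p\<in>F. p x = 0}"

definition zariski :: "'a affine_space \<Rightarrow> 'a topology" where
  "zariski S = topology (\<lambda>U. \<exists>F \<subseteq> poly_funs S. U = points S - zero_locus S F)"

lemma istopology_zariski:
  "istopology (\<lambda>U. \<exists>F \<subseteq> poly_funs S. U = points S - zero_locus S F)"
  unfolding istopology_def
proof (intro conjI allI impI)
  fix U V
  assume "\<exists>F \<subseteq> poly_funs S. U = points S - zero_locus S F"
    and "\<exists>F \<subseteq> poly_funs S. V = points S - zero_locus S F"
  then obtain F G where F: "F \<subseteq> poly_funs S" "U = points S - zero_locus S F"
    and G: "G \<subseteq> poly_funs S" "V = points S - zero_locus S G" by blast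
  let ?H = "{\<lambda>x. p x * q x | p q. p \<in> F \<and> q \<in> G}"
  have "?H \<subseteq> poly_funs S" using F(1) G(1) by (auto intro: poly_funs.mult)
  moreover have "U \<inter> V = points S - zero_locus S ?H"
  proof (intro equalityI subsetI)
    fix x
    assume "x \<in> U \<inter> V"
    then obtain p q where "x \<in> points S" "p \<in> F" "p x \<noteq> 0" "q \<in> G" "q x \<noteq> 0"
      unfolding F(2) G(2) zero_locus_def by blast
    then have "(\<lambda>x. p x * q x) \<in> ?H" "p x * q x \<noteq> 0" "x \<in> points S" by auto
    then show "x \<in> points S - zero_locus S ?H" unfolding zero_locus_def by fast
  next
    fix x
    assume "x \<in> points S - zero_locus S ?H"
    then obtain p q where "x \<in> points S" "p \<in> F" "q \<in> G" "p x * q x \<noteq> 0"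
      unfolding zero_locus_def by blast
    then show "x \<in> U \<inter> V" unfolding F(2) G(2) zero_locus_def by auto
  qed
  ultimately show "\<exists>F \<subseteq> poly_funs S. U \<inter> V = points S - zero_locus S F" by blast
next
  fix K
  assume "\<forall>U\<in>K. \<exists>F \<subseteq> poly_funs S. U = points S - zero_locus S F"
  then obtain F where F: "\<And>U. U \<in> K \<Longrightarrow> F U \<subseteq> poly_funs S \<and> U = points S - zero_locus S (F U)"
    by metis
  have "\<Union>K = points S - zero_locus S (\<Union>(F ` K))"
  proof -
    have "(\<Union>U\<in>K. points S - zero_locus S (F U)) = (\<Union>U\<in>K. U)"
      by (rule SUP_cong) (use F in simp_all)
    then have "\<Union>K = (\<Union>U\<in>K. points S - zero_locus S (F U))" by simp
    also have "\<dots> = points S - zero_locus S (\<Union>(F ` K))" unfolding zero_locus_def by blast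
    finally show ?thesis .
  qed
  moreover have "\<Union>(F ` K) \<subseteq> poly_funs S" using F by blast
  ultimately show "\<exists>F \<subseteq> poly_funs S. \<Union>K = points S - zero_locus S F" by blast
qed

lemma openin_zariski:
  "openin (zariski S) U \<longleftrightarrow> (\<exists>F \<subseteq> poly_funs S. U = points S - zero_locus S F)"
  unfolding zariski_def topology_inverse'[OF istopology_zariski] ..

lemma topspace_zariski [simp]: "topspace (zariski S) = points S"
proof
  have "\<exists>F \<subseteq> poly_funs S. topspace (zariski S) = points S - zero_locus S F"
    by (rule openin_zariski[THEN iffD1]) (rule openin_topspace)
  then obtain F where "topspace (zariski S) = points S - zero_locus S F" by (elim exE conjE)
  then show "topspace (zariski S) \<subseteq> points S" by (simp only: Diff_subset)
  have "points S = points S - zero_locus S {\<lambda>_. 1}" by (simp add: zero_locus_def)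
  moreover have "{\<lambda>_. 1} \<subseteq> poly_funs S" by (simp add: poly_funs.const)
  ultimately have "openin (zariski S) (points S)"
    by (intro openin_zariski[THEN iffD2] exI conjI)
  then show "points S \<subseteq> topspace (zariski S)" by (rule openin_subset)
qed

lemma closedin_zariski:
  "closedin (zariski S) Z \<longleftrightarrow> (\<exists>F \<subseteq> poly_funs S. Z = zero_locus S F)"
proof -
  have sub: "zero_locus S F \<subseteq> points S" for F by (auto simp: zero_locus_def)
  have "Z \<subseteq> points S \<and> points S - Z = points S - zero_locus S F \<longleftrightarrow> Z = zero_locus S F" for F
    using sub[of F] by blast
  then have "(\<exists>F \<subseteq> poly_funs S. Z = zero_locus S F) \<longleftrightarrow>
      (\<exists>F \<subseteq> poly_funs S. Z \<subseteq> points S \<and> points S - Z = points S - zero_locus S F)"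
    by (simp only:)
  then show ?thesis
    by (simp only: closedin_def openin_zariski topspace_zariski ex_simps conj_left_commute)
qed

definition irreducible_space :: "'a topology \<Rightarrow> bool" where
  "irreducible_space T \<longleftrightarrow>
    topspace T \<noteq> {} \<and>
    (\<forall>U V. openin T U \<and> openin T V \<and> U \<noteq> {} \<and> V \<noteq> {} \<longrightarrow> U \<inter> V \<noteq> {})"

definition affine_variety :: "'a affine_space \<Rightarrow> 'a set \<Rightarrow> bool" where
  "affine_variety S X \<longleftrightarrow>
    closedin (zariski S) X \<and> irreducible_space (subtopology (zariski S) X)"

text \<open>
  Regular functions and maps are defined on locally closed subsets with the reduced structure.
\<close>

definition regular_function :: "'a affine_space \<Rightarrow> 'a set \<Rightarrow> ('a \<Rightarrow> complex) \<Rightarrow> bool" where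
  "regular_function S U g \<longleftrightarrow>
    (\<forall>x\<in>U. \<exists>W. openin (subtopology (zariski S) U) W \<and> x \<in> W \<and>
      (\<exists>p\<in>poly_funs S. \<exists>q\<in>poly_funs S. \<forall>y\<in>W. q y \<noteq> 0 \<and> g y = p y / q y))"

definition regular_map ::
    "'a affine_space \<Rightarrow> 'a set \<Rightarrow> 'b affine_space \<Rightarrow> 'b set \<Rightarrow> ('a \<Rightarrow> 'b) \<Rightarrow> bool" where
  "regular_map S U T V h \<longleftrightarrow>
    h ` U \<subseteq> V \<and> (\<forall>c\<in>coords T. regular_function S U (c \<circ> h))"

definition variety_iso ::
    "'a affine_space \<Rightarrow> 'a set \<Rightarrow> 'b affine_space \<Rightarrow> 'b set \<Rightarrow> ('a \<Rightarrow> 'b) \<Rightarrow> bool" where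
  "variety_iso S U T V h \<longleftrightarrow>
    regular_map S U T V h \<and>
    (\<exists>g. regular_map T V S U g \<and> (\<forall>x\<in>U. g (h x) = x) \<and> (\<forall>y\<in>V. h (g y) = y))"

definition birational_morphism ::
    "'a affine_space \<Rightarrow> 'a set \<Rightarrow> 'b affine_space \<Rightarrow> 'b set \<Rightarrow> ('a \<Rightarrow> 'b) \<Rightarrow> bool" where
  "birational_morphism S X T Y h \<longleftrightarrow>
    affine_variety S X \<and> affine_variety T Y \<and> regular_map S X T Y h \<and>
    (\<exists>U V. openin (subtopology (zariski S) X) U \<and> U \<noteq> {} \<and>
           openin (subtopology (zariski T) Y) V \<and> V \<noteq> {} \<and>
           variety_iso S U T V h)"

definition birational_onto_image ::
    "'a affine_space \<Rightarrow> 'a set \<Rightarrow> 'b affine_space \<Rightarrow> ('a \<Rightarrow> 'b) \<Rightarrow> bool" where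
  "birational_onto_image S X T h \<longleftrightarrow>
    h ` X \<subseteq> points T \<and>
    birational_morphism S X T (Abstract_Topology.closure_of (zariski T) (h ` X)) h"

definition power_sum :: "nat \<Rightarrow> complex vec \<Rightarrow> complex" where
  "power_sum k y = (\<Sum>i<dim_vec y. (y $ i) ^ k)"

text \<open>Vectors are indexed from $0$, so entry $k$ of the last component is $p_{k+1}(A\xi)$.\<close>

definition power_sum_map ::
    "nat \<Rightarrow> complex mat \<times> complex vec \<Rightarrow> complex mat \<times> complex vec" where
  "power_sum_map n = (\<lambda>(A, \<xi>). (A, vec (n + 1) (\<lambda>k. power_sum (k + 1) (A *\<^sub>v \<xi>))))"

end

theory Submission
  imports Defs "HOL-Computational_Algebra.Fundamental_Theorem_Algebra" "HOL-Combinatorics.Permutations"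
begin

text \<open>
  Let \<open>y = A \<xi>\<close> and let \<open>e\<^sub>1, \<dots>, e\<^sub>n\<^sub>+\<^sub>1\<close> be the elementary symmetric functions of the \<open>m\<close> entries of
  \<open>y\<close>. By Newton's identities they are polynomials in the power sums, so it suffices to write each
  \<open>\<xi>\<^sub>j\<close> as a quotient of polynomials in \<open>A\<close> and \<open>e\<^sub>1, \<dots>, e\<^sub>n\<^sub>+\<^sub>1\<close> whose denominator does not vanish
  identically (\<open>coordinate_is_fraction\<close>). Such quotients give a rational left inverse, and a map
  with a rational left inverse is birational onto the closure of its image
  (\<open>birational_onto_imageI\<close>). Let \<open>N = n!\<close>. The quotients come from two facts.

  There is a nontrivial linear relation between \<open>\<xi>\<^sub>j\<close> and the powers of \<open>e\<^sub>n\<^sub>+\<^sub>1\<close> with exponent less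
  than \<open>N\<close>, with coefficients that are polynomials in \<open>A, e\<^sub>1, \<dots>, e\<^sub>n\<close> (\<open>algebraic_relation\<close>). This is a
  dimension count: since \<open>e\<^sub>k\<close> has degree \<open>k\<close> in \<open>\<xi>\<close>, there are about \<open>d\<^sup>n / (n!)\<^sup>2\<close> monomials of
  degree at most \<open>d\<close> in \<open>e\<^sub>1, \<dots>, e\<^sub>n\<close>, and about \<open>d\<^sup>n / n!\<close> monomials of degree at most \<open>d\<close> in
  \<open>\<xi>\<close>, so that \<open>N + 1\<close> elements cannot be independent.

  There is no such relation between these powers of \<open>e\<^sub>n\<^sub>+\<^sub>1\<close> alone (\<open>esym_powers_independent\<close>), so
  \<open>\<xi>\<^sub>j\<close> occurs in the first relation with a coefficient that is not zero. To see this, put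
  \<open>A = A\<^sub>0 + t B\<close>, where \<open>A\<^sub>0\<close> is an identity block on top of zero rows. At \<open>t = 0\<close> the functions
  \<open>e\<^sub>1, \<dots>, e\<^sub>n\<close> of \<open>y\<close> become those of \<open>\<xi>\<close>, which are symmetric in \<open>\<xi>\<close>. On the other hand
  \<open>e\<^sub>n\<^sub>+\<^sub>1\<close> is divisible by \<open>t\<close>, and \<open>e\<^sub>n\<^sub>+\<^sub>1 / t\<close> tends to \<open>\<xi>\<^sub>1 \<cdots> \<xi>\<^sub>n (b \<bullet> \<xi>)\<close>, where \<open>b\<close> is the sum of the
  rows of \<open>B\<close> below the identity block; there is such a row because \<open>m > n\<close>. The terms of lowest
  order in \<open>t\<close> of a relation therefore form a polynomial of degree less than \<open>N\<close> in one variable.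
  Permuting \<open>\<xi>\<close> does not change its coefficients, so it has the \<open>N\<close> roots
  \<open>\<xi>\<^sub>1 \<cdots> \<xi>\<^sub>n (b \<bullet> \<sigma> \<xi>)\<close>, which are distinct for generic \<open>B\<close> and \<open>\<xi>\<close>.
\<close>

section \<open>Algebras of polynomial functions\<close>

lemma poly_funs_sum:
  assumes "\<And>i. i \<in> I \<Longrightarrow> f i \<in> poly_funs S"
  shows "(\<lambda>x. \<Sum>i\<in>I. f i x) \<in> poly_funs S"
  using assms
  by (induction I rule: infinite_finite_induct) (auto intro: poly_funs.add poly_funs.const)

lemma poly_funs_prod:
  assumes "\<And>i. i \<in> I \<Longrightarrow> f i \<in> poly_funs S"
  shows "(\<lambda>x. \<Prod>i\<in>I. f i x) \<in> poly_funs S"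
  using assms
  by (induction I rule: infinite_finite_induct) (auto intro: poly_funs.mult poly_funs.const)

lemma poly_funs_power:
  assumes "f \<in> poly_funs S"
  shows "(\<lambda>x. f x ^ k) \<in> poly_funs S"
  using assms by (induction k) (auto intro: poly_funs.mult poly_funs.const)

lemma poly_funs_cmult:
  assumes "f \<in> poly_funs S"
  shows "(\<lambda>x. a * f x) \<in> poly_funs S"
  by (intro poly_funs.mult poly_funs.const assms)

lemma poly_funs_uminus:
  assumes "f \<in> poly_funs S"
  shows "(\<lambda>x. - f x) \<in> poly_funs S"
  using poly_funs_cmult[OF assms, of "-1"] by simp

lemma poly_funs_diff:
  assumes "f \<in> poly_funs S" "g \<in> poly_funs S"
  shows "(\<lambda>x. f x - g x) \<in> poly_funs S"
  using poly_funs.add[OF assms(1) poly_funs_uminus[OF assms(2)]] by simp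

lemmas poly_funs_intros =
  poly_funs.const poly_funs.add poly_funs.mult poly_funs_sum poly_funs_prod poly_funs_power
  poly_funs_uminus poly_funs_diff

lemma poly_funs_compose:
  assumes "p \<in> poly_funs T" "\<And>c. c \<in> coords T \<Longrightarrow> (\<lambda>x. c (h x)) \<in> poly_funs S"
  shows "(\<lambda>x. p (h x)) \<in> poly_funs S"
  using assms(1) by induction (auto intro: poly_funs_intros assms(2))

lemma poly_funs_compose_on_points:
  assumes "p \<in> poly_funs T"
    and "\<And>c. c \<in> coords T \<Longrightarrow> \<exists>q\<in>poly_funs S. \<forall>x\<in>points S. c (h x) = q x"
  shows "\<exists>q\<in>poly_funs S. \<forall>x\<in>points S. p (h x) = q x"
  using assms(1)
proof induction
  case (coord c)
  then show ?case by (rule assms(2))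
next
  case (const a)
  show ?case by (rule bexI[of _ "\<lambda>_. a"]) (auto intro: poly_funs.const)
next
  case (add p q)
  then obtain p' q' where "p' \<in> poly_funs S" "q' \<in> poly_funs S"
    "\<forall>x\<in>points S. p (h x) = p' x" "\<forall>x\<in>points S. q (h x) = q' x" by blast
  then show ?case by (intro bexI[of _ "\<lambda>x. p' x + q' x"]) (auto intro: poly_funs.add)
next
  case (mult p q)
  then obtain p' q' where "p' \<in> poly_funs S" "q' \<in> poly_funs S"
    "\<forall>x\<in>points S. p (h x) = p' x" "\<forall>x\<in>points S. q (h x) = q' x" by blast
  then show ?case by (intro bexI[of _ "\<lambda>x. p' x * q' x"]) (auto intro: poly_funs.mult)
qed

lemma poly_funs_along_curve:
  assumes "p \<in> poly_funs S" "\<And>c. c \<in> coords S \<Longrightarrow> \<exists>P. \<forall>t. c (\<gamma> t) = poly P t"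
  shows "\<exists>P. \<forall>t. p (\<gamma> t) = poly P t"
  using assms(1)
proof induction
  case (coord c)
  then show ?case by (rule assms(2))
next
  case (const a)
  show ?case by (rule exI[of _ "[:a:]"]) simp
next
  case (add p q)
  then obtain P Q where "\<forall>t. p (\<gamma> t) = poly P t" "\<forall>t. q (\<gamma> t) = poly Q t" by blast
  then show ?case by (intro exI[of _ "P + Q"]) simp
next
  case (mult p q)
  then obtain P Q where "\<forall>t. p (\<gamma> t) = poly P t" "\<forall>t. q (\<gamma> t) = poly Q t" by blast
  then show ?case by (intro exI[of _ "P * Q"]) simp
qed

text \<open>
  Total functions on an index set take the place of matrices and vectors in all the auxiliary
  computations, so that no dimensions have to be carried along; the indices outside \<open>V\<close> are
  invisible to the polynomial functions.
\<close>

definition fun_affine :: "'v set \<Rightarrow> ('v \<Rightarrow> complex) affine_space" where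
  "fun_affine V = \<lparr>points = UNIV, coords = {\<lambda>x. x v | v. v \<in> V}\<rparr>"

lemma points_fun_affine [simp]: "points (fun_affine V) = UNIV"
  by (simp add: fun_affine_def)

lemma points_prod_affine [simp]: "points (S \<times>\<^sub>A T) = points S \<times> points T"
  by (simp add: prod_affine_def)

lemma fun_affine_coord: "v \<in> V \<Longrightarrow> (\<lambda>x. x v) \<in> poly_funs (fun_affine V)"
  by (rule poly_funs.coord) (auto simp: fun_affine_def)

lemma poly_funs_fst:
  assumes "p \<in> poly_funs S"
  shows "(\<lambda>z. p (fst z)) \<in> poly_funs (S \<times>\<^sub>A T)"
  using assms
  by (rule poly_funs_compose) (auto intro!: poly_funs.coord simp: prod_affine_def comp_def)

lemma poly_funs_snd:
  assumes "p \<in> poly_funs T"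
  shows "(\<lambda>z. p (snd z)) \<in> poly_funs (S \<times>\<^sub>A T)"
  using assms
  by (rule poly_funs_compose) (auto intro!: poly_funs.coord simp: prod_affine_def comp_def)

lemma poly_funs_compose_fun_affine:
  assumes "p \<in> poly_funs (fun_affine V \<times>\<^sub>A fun_affine W)"
    and "\<And>v. v \<in> V \<Longrightarrow> (\<lambda>x. f x v) \<in> poly_funs S" "\<And>w. w \<in> W \<Longrightarrow> (\<lambda>x. g x w) \<in> poly_funs S"
  shows "(\<lambda>x. p (f x, g x)) \<in> poly_funs S"
  using assms(1)
  by (rule poly_funs_compose) (auto simp: prod_affine_def fun_affine_def intro: assms(2,3))

text \<open>
  Any two points lie on a polynomially parametrised curve. This is all that is needed for
  integrality of the algebra of polynomial functions, because a polynomial in one variable that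
  is not zero has finitely many zeros.
\<close>

definition curve_connected :: "'a affine_space \<Rightarrow> bool" where
  "curve_connected S \<longleftrightarrow> (\<forall>x\<in>points S. \<forall>y\<in>points S. \<exists>\<gamma>. \<gamma> 0 = x \<and> \<gamma> 1 = y \<and>
     (\<forall>t. \<gamma> t \<in> points S) \<and> (\<forall>c\<in>coords S. \<exists>P. \<forall>t::complex. c (\<gamma> t) = poly P t))"

lemma curve_connectedE:
  assumes "curve_connected S" "x \<in> points S" "y \<in> points S"
  obtains \<gamma> where "\<gamma> 0 = x" "\<gamma> 1 = y" "\<And>t. \<gamma> t \<in> points S"
    "\<And>c. c \<in> coords S \<Longrightarrow> \<exists>P. \<forall>t::complex. c (\<gamma> t) = poly P t"
  using assms unfolding curve_connected_def by blast

lemma curve_connected_prod: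
  assumes "curve_connected S" "curve_connected T"
  shows "curve_connected (S \<times>\<^sub>A T)"
  unfolding curve_connected_def
proof (intro ballI)
  fix x y assume "x \<in> points (S \<times>\<^sub>A T)" "y \<in> points (S \<times>\<^sub>A T)"
  then have xy: "fst x \<in> points S" "fst y \<in> points S" "snd x \<in> points T" "snd y \<in> points T"
    by auto
  obtain \<gamma> where 1: "\<gamma> 0 = fst x" "\<gamma> 1 = fst y" "\<And>t. \<gamma> t \<in> points S"
    "\<And>c. c \<in> coords S \<Longrightarrow> \<exists>P. \<forall>t::complex. c (\<gamma> t) = poly P t"
    using curve_connectedE[OF assms(1) xy(1,2)] by metis
  obtain \<delta> where 2: "\<delta> 0 = snd x" "\<delta> 1 = snd y" "\<And>t. \<delta> t \<in> points T"
    "\<And>c. c \<in> coords T \<Longrightarrow> \<exists>P. \<forall>t::complex. c (\<delta> t) = poly P t"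
    using curve_connectedE[OF assms(2) xy(3,4)] by metis
  show "\<exists>\<gamma>. \<gamma> 0 = x \<and> \<gamma> 1 = y \<and> (\<forall>t. \<gamma> t \<in> points (S \<times>\<^sub>A T)) \<and>
      (\<forall>c\<in>coords (S \<times>\<^sub>A T). \<exists>P. \<forall>t::complex. c (\<gamma> t) = poly P t)"
    using 1 2 by (intro exI[of _ "\<lambda>t. (\<gamma> t, \<delta> t)"]) (auto simp: prod_affine_def)
qed

lemma poly_line: "\<exists>P. \<forall>t. (a::complex) + t * (b - a) = poly P t"
  by (rule exI[of _ "[:a, b - a:]"]) simp

lemma curve_connected_fun_affine: "curve_connected (fun_affine V)"
  unfolding curve_connected_def
proof (intro ballI)
  fix x y :: "'a \<Rightarrow> complex"
  show "\<exists>\<gamma>. \<gamma> 0 = x \<and> \<gamma> 1 = y \<and> (\<forall>t. \<gamma> t \<in> points (fun_affine V)) \<and>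
      (\<forall>c\<in>coords (fun_affine V). \<exists>P. \<forall>t::complex. c (\<gamma> t) = poly P t)"
    by (rule exI[of _ "\<lambda>t v. x v + t * (y v - x v)"]) (auto simp: fun_affine_def poly_line)
qed

lemma curve_connected_vec_affine: "curve_connected (vec_affine n)"
  unfolding curve_connected_def
proof (intro ballI)
  fix x y :: "complex vec" assume xy: "x \<in> points (vec_affine n)" "y \<in> points (vec_affine n)"
  show "\<exists>\<gamma>. \<gamma> 0 = x \<and> \<gamma> 1 = y \<and> (\<forall>t. \<gamma> t \<in> points (vec_affine n)) \<and>
      (\<forall>c\<in>coords (vec_affine n). \<exists>P. \<forall>t::complex. c (\<gamma> t) = poly P t)"
    using xy by (intro exI[of _ "\<lambda>t. vec n (\<lambda>i. x $ i + t * (y $ i - x $ i))"])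
      (auto simp: vec_affine_def poly_line)
qed

lemma curve_connected_mat_affine: "curve_connected (mat_affine m n)"
  unfolding curve_connected_def
proof (intro ballI)
  fix x y :: "complex mat"
  assume xy: "x \<in> points (mat_affine m n)" "y \<in> points (mat_affine m n)"
  show "\<exists>\<gamma>. \<gamma> 0 = x \<and> \<gamma> 1 = y \<and> (\<forall>t. \<gamma> t \<in> points (mat_affine m n)) \<and>
      (\<forall>c\<in>coords (mat_affine m n). \<exists>P. \<forall>t::complex. c (\<gamma> t) = poly P t)"
    using xy
    by (intro exI[of _ "\<lambda>t. mat m n (\<lambda>ij. x $$ ij + t * (y $$ ij - x $$ ij))"])
      (auto simp: mat_affine_def poly_line)
qed

lemma nonzero_poly_funs_common_point:
  assumes "curve_connected S" "p \<in> poly_funs S" "q \<in> poly_funs S"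
    and "x \<in> points S" "p x \<noteq> 0" "y \<in> points S" "q y \<noteq> 0"
  shows "\<exists>z\<in>points S. p z \<noteq> 0 \<and> q z \<noteq> 0"
proof -
  obtain \<gamma> where \<gamma>: "\<gamma> 0 = x" "\<gamma> 1 = y" "\<And>t. \<gamma> t \<in> points S"
    "\<And>c. c \<in> coords S \<Longrightarrow> \<exists>P. \<forall>t::complex. c (\<gamma> t) = poly P t"
    using curve_connectedE[OF assms(1,4,6)] by metis
  obtain P where P: "\<And>t. p (\<gamma> t) = poly P t" using poly_funs_along_curve[where \<gamma> = \<gamma>, OF assms(2) \<gamma>(4)] by blast
  obtain Q where Q: "\<And>t. q (\<gamma> t) = poly Q t" using poly_funs_along_curve[where \<gamma> = \<gamma>, OF assms(3) \<gamma>(4)] by blast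
  have "P \<noteq> 0" using P[of 0] \<gamma>(1) assms(5) by auto
  moreover have "Q \<noteq> 0" using Q[of 1] \<gamma>(2) assms(7) by auto
  ultimately have "P * Q \<noteq> 0" by simp
  then obtain t where "poly (P * Q) t \<noteq> 0" using poly_all_0_iff_0 by blast
  then show ?thesis using P Q \<gamma>(3) by (intro bexI[of _ "\<gamma> t"]) auto
qed

text \<open>
  The form in which points are chosen generically below: integrality, applied to the product of
  finitely many functions, makes conditions that can be met one by one compatible.
\<close>

lemma finite_nonzero_poly_funs_common_point:
  assumes S: "curve_connected S" "points S \<noteq> {}" and I: "finite I"
    and "\<And>i. i \<in> I \<Longrightarrow> p i \<in> poly_funs S" "\<And>i. i \<in> I \<Longrightarrow> \<exists>x\<in>points S. p i x \<noteq> 0"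
  shows "\<exists>z\<in>points S. \<forall>i\<in>I. p i z \<noteq> 0"
  using I assms(4,5)
proof (induction I)
  case empty
  then show ?case using S(2) by auto
next
  case (insert j I)
  obtain x where x: "x \<in> points S" "p j x \<noteq> 0" using insert.prems(2) by blast
  obtain y where y: "y \<in> points S" "\<forall>i\<in>I. p i y \<noteq> 0"
    using insert.IH insert.prems by blast
  have "(\<Prod>i\<in>I. p i y) \<noteq> 0" using y insert.hyps by simp
  moreover have "(\<lambda>x. \<Prod>i\<in>I. p i x) \<in> poly_funs S" using insert.prems by (intro poly_funs_prod) auto
  ultimately obtain z where "z \<in> points S" "p j z \<noteq> 0" "(\<Prod>i\<in>I. p i z) \<noteq> 0"
    using nonzero_poly_funs_common_point[where p = "p j" and q = "\<lambda>x. \<Prod>i\<in>I. p i x" and S = S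
        and x = x and y = y] S(1) x y(1) insert.prems(1) by blast
  then show ?case using insert.hyps by (intro bexI[of _ z]) auto
qed

section \<open>A criterion for birationality\<close>

lemma vanishing_on_closure:
  assumes "D \<subseteq> points T" "p \<in> poly_funs T" "\<And>y. y \<in> D \<Longrightarrow> p y = 0"
    and "y \<in> Abstract_Topology.closure_of (zariski T) D"
  shows "p y = 0"
proof -
  have "closedin (zariski T) (zero_locus T {p})"
    unfolding closedin_zariski using assms(2) by blast
  moreover have "D \<subseteq> zero_locus T {p}" using assms(1,3) by (auto simp: zero_locus_def)
  ultimately have "Abstract_Topology.closure_of (zariski T) D \<subseteq> zero_locus T {p}"
    by (rule closure_of_minimal[rotated])
  then show ?thesis using assms(4) by (auto simp: zero_locus_def)
qed

lemma affine_variety_closure_of_image: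
  assumes S: "curve_connected S" "points S \<noteq> {}" and h: "h ` points S \<subseteq> points T"
    "\<And>c. c \<in> coords T \<Longrightarrow> \<exists>q\<in>poly_funs S. \<forall>x\<in>points S. c (h x) = q x"
  shows "affine_variety T (Abstract_Topology.closure_of (zariski T) (h ` points S))"
    (is "affine_variety T ?Y")
proof -
  have Y: "?Y \<subseteq> points T" using closure_of_subset_topspace[of "zariski T"] by simp
  have img: "h ` points S \<subseteq> ?Y" using closure_of_subset[of "h ` points S" "zariski T"] h by simp
  have ne: "\<exists>p\<in>poly_funs T. (\<exists>x\<in>points S. p (h x) \<noteq> 0) \<and> (\<forall>y\<in>?Y. p y \<noteq> 0 \<longrightarrow> y \<in> U)"
    if U: "openin (subtopology (zariski T) ?Y) U" "U \<noteq> {}" for U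
  proof -
    obtain F where F: "F \<subseteq> poly_funs T" "U = (points T - zero_locus T F) \<inter> ?Y"
      using U(1) unfolding openin_subtopology openin_zariski by blast
    obtain y p where y: "y \<in> ?Y" "p \<in> F" "p y \<noteq> 0"
      using U(2) F(2) by (auto simp: zero_locus_def)
    have p: "p \<in> poly_funs T" using y F(1) by blast
    have "\<exists>x\<in>points S. p (h x) \<noteq> 0"
      using vanishing_on_closure[OF h(1) p _ y(1)] y(3) by blast
    moreover have "\<forall>y\<in>?Y. p y \<noteq> 0 \<longrightarrow> y \<in> U"
      using Y y(2) unfolding F(2) zero_locus_def by blast
    ultimately show ?thesis using p by blast
  qed
  have "irreducible_space (subtopology (zariski T) ?Y)"
    unfolding irreducible_space_def
  proof (intro conjI allI impI)
    show "topspace (subtopology (zariski T) ?Y) \<noteq> {}" using S(2) img Y by auto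
  next
    fix U V assume *: "openin (subtopology (zariski T) ?Y) U \<and> openin (subtopology (zariski T) ?Y) V \<and>
      U \<noteq> {} \<and> V \<noteq> {}"
    obtain p where p: "p \<in> poly_funs T" "\<exists>x\<in>points S. p (h x) \<noteq> 0" "\<forall>y\<in>?Y. p y \<noteq> 0 \<longrightarrow> y \<in> U"
      using ne * by blast
    obtain q where q: "q \<in> poly_funs T" "\<exists>x\<in>points S. q (h x) \<noteq> 0" "\<forall>y\<in>?Y. q y \<noteq> 0 \<longrightarrow> y \<in> V"
      using ne * by blast
    obtain p' where p': "p' \<in> poly_funs S" "\<forall>x\<in>points S. p (h x) = p' x"
      using poly_funs_compose_on_points[where h = h, OF p(1) h(2)] by blast
    obtain q' where q': "q' \<in> poly_funs S" "\<forall>x\<in>points S. q (h x) = q' x"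
      using poly_funs_compose_on_points[where h = h, OF q(1) h(2)] by blast
    obtain z where "z \<in> points S" "p' z \<noteq> 0" "q' z \<noteq> 0"
      using nonzero_poly_funs_common_point[OF S(1) p'(1) q'(1)] p(2) q(2) p'(2) q'(2) by metis
    then have "h z \<in> U \<inter> V" using p(3) q(3) p'(2) q'(2) img by auto
    then show "U \<inter> V \<noteq> {}" by blast
  qed
  then show ?thesis unfolding affine_variety_def by simp
qed

lemma affine_variety_points:
  assumes "curve_connected S" "points S \<noteq> {}"
  shows "affine_variety S (points S)"
proof -
  have "Abstract_Topology.closure_of (zariski S) (points S) = points S"
    using closure_of_topspace[of "zariski S"] by simp
  moreover have "affine_variety S (Abstract_Topology.closure_of (zariski S) ((\<lambda>x. x) ` points S))"
    by (rule affine_variety_closure_of_image[OF assms]) (auto intro: poly_funs.coord)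
  ultimately show ?thesis by simp
qed

text \<open>
  Each factor of a monomial contributes one \<open>Q\<close> to the common denominator, so the exponent \<open>k\<close> is
  bounded in terms of the degree of \<open>p\<close>.
\<close>

lemma poly_funs_compose_fractions:
  assumes "p \<in> poly_funs S" and Q: "Q \<in> poly_funs T"
    and g: "\<And>c. c \<in> coords S \<Longrightarrow> \<exists>P\<in>poly_funs T. \<forall>y\<in>D. c (g y) * Q y = P y"
  shows "\<exists>k. \<exists>P\<in>poly_funs T. \<forall>y\<in>D. p (g y) * Q y ^ k = P y"
  using assms(1)
proof induction
  case (coord c)
  then show ?case using g[of c] by (intro exI[of _ 1]) auto
next
  case (const a)
  show ?case by (rule exI[of _ 0], rule bexI[of _ "\<lambda>_. a"]) (auto intro: poly_funs.const)
next
  case (add p q)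
  then obtain k l P R where *: "P \<in> poly_funs T" "R \<in> poly_funs T"
    "\<forall>y\<in>D. p (g y) * Q y ^ k = P y" "\<forall>y\<in>D. q (g y) * Q y ^ l = R y" by blast
  have "(p (g y) + q (g y)) * Q y ^ (k + l) = P y * Q y ^ l + R y * Q y ^ k" if "y \<in> D" for y
    using *(3,4)[rule_format, OF that, symmetric] by (simp add: algebra_simps power_add)
  then show ?case
    by (intro exI[of _ "k + l"] bexI[of _ "\<lambda>y. P y * Q y ^ l + R y * Q y ^ k"])
      (auto intro!: poly_funs_intros * Q)
next
  case (mult p q)
  then obtain k l P R where *: "P \<in> poly_funs T" "R \<in> poly_funs T"
    "\<forall>y\<in>D. p (g y) * Q y ^ k = P y" "\<forall>y\<in>D. q (g y) * Q y ^ l = R y" by blast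
  have "(p (g y) * q (g y)) * Q y ^ (k + l) = P y * R y" if "y \<in> D" for y
    using *(3,4)[rule_format, OF that, symmetric] by (simp add: algebra_simps power_add)
  then show ?case
    by (intro exI[of _ "k + l"] bexI[of _ "\<lambda>y. P y * R y"]) (auto intro!: poly_funs_intros *)
qed

text \<open>
  A left inverse \<open>g\<close> of \<open>h\<close> whose coordinates are fractions with denominator \<open>Q\<close> is also a right
  inverse where \<open>Q\<close> does not vanish on the closure of the image: the equation \<open>h (g y) = y\<close> is
  polynomial after clearing denominators, and it holds on the image, which is dense. So \<open>h\<close>
  restricts to an isomorphism from the locus where \<open>Q \<circ> h\<close> is not zero.
\<close>

lemma birational_onto_imageI:
  fixes S :: "'a affine_space" and T :: "'b affine_space"
  assumes S: "curve_connected S" and h: "h ` points S \<subseteq> points T"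
    "\<And>c. c \<in> coords T \<Longrightarrow> \<exists>q\<in>poly_funs S. \<forall>x\<in>points S. c (h x) = q x"
    and T: "\<And>y y'. y \<in> points T \<Longrightarrow> y' \<in> points T \<Longrightarrow> (\<And>c. c \<in> coords T \<Longrightarrow> c y = c y') \<Longrightarrow> y = y'"
    and Q: "Q \<in> poly_funs T" "\<exists>x\<in>points S. Q (h x) \<noteq> 0"
    and g: "\<And>y. y \<in> points T \<Longrightarrow> g y \<in> points S"
    "\<And>c. c \<in> coords S \<Longrightarrow> \<exists>P\<in>poly_funs T. \<forall>y\<in>points T. Q y \<noteq> 0 \<longrightarrow> c (g y) * Q y = P y"
    and gh: "\<And>x. x \<in> points S \<Longrightarrow> Q (h x) \<noteq> 0 \<Longrightarrow> g (h x) = x"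
  shows "birational_onto_image S (points S) T h"
proof -
  define Y where "Y = Abstract_Topology.closure_of (zariski T) (h ` points S)"
  define U where "U = {x \<in> points S. Q (h x) \<noteq> 0}"
  define V where "V = {y \<in> Y. Q y \<noteq> 0}"
  have ne: "points S \<noteq> {}" using Q(2) by blast
  have YT: "Y \<subseteq> points T" unfolding Y_def using closure_of_subset_topspace[of "zariski T"] by simp
  have hY: "h ` points S \<subseteq> Y"
    unfolding Y_def using closure_of_subset[of "h ` points S" "zariski T"] h by simp
  have reg_poly: "regular_function R W f"
    if "W \<subseteq> points R" "p \<in> poly_funs R" "\<And>x. x \<in> W \<Longrightarrow> f x = p x" for R :: "'a affine_space" and W f p
    unfolding regular_function_def
  proof (intro ballI exI conjI bexI)
    show "openin (subtopology (zariski R) W) W" using that(1) by (simp add: openin_subtopology_refl)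
    show "(\<lambda>_. 1) \<in> poly_funs R" "p \<in> poly_funs R" by (auto intro: poly_funs.const that)
  qed (auto simp: that)
  have reg_h: "regular_map S W T Z h" if "W \<subseteq> points S" "h ` W \<subseteq> Z" for W Z
    unfolding regular_map_def
  proof (intro conjI ballI)
    fix c assume "c \<in> coords T"
    then obtain q where "q \<in> poly_funs S" "\<forall>x\<in>points S. c (h x) = q x" using h(2) by blast
    then show "regular_function S W (c \<circ> h)" using that(1) by (intro reg_poly[of _ _ q]) auto
  qed (use that in auto)
  have hg: "h (g y) = y" if y: "y \<in> V" for y
  proof (rule T)
    show yT: "y \<in> points T" using y YT by (auto simp: V_def)
    show "h (g y) \<in> points T" using h(1) g(1)[OF yT] by blast
    fix c assume c: "c \<in> coords T"
    obtain q where q: "q \<in> poly_funs S" "\<forall>x\<in>points S. c (h x) = q x" using h(2)[OF c] by blast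
    have "\<exists>k. \<exists>P\<in>poly_funs T. \<forall>y\<in>{y\<in>points T. Q y \<noteq> 0}. q (g y) * Q y ^ k = P y"
      using q(1) Q(1)
    proof (rule poly_funs_compose_fractions)
      fix c assume "c \<in> coords S"
      from g(2)[OF this] show "\<exists>P\<in>poly_funs T. \<forall>y\<in>{y \<in> points T. Q y \<noteq> 0}. c (g y) * Q y = P y"
        by blast
    qed
    then obtain k P where P: "P \<in> poly_funs T"
      "\<And>y. y \<in> points T \<Longrightarrow> Q y \<noteq> 0 \<Longrightarrow> q (g y) * Q y ^ k = P y" by blast
    \<comment> \<open>The extra factor \<open>Q\<close> covers the points of the image where \<open>Q\<close> vanishes.\<close>
    have "(\<lambda>y. Q y * (P y - c y * Q y ^ k)) y = 0"
    proof (rule vanishing_on_closure[OF h(1)])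
      show "(\<lambda>y. Q y * (P y - c y * Q y ^ k)) \<in> poly_funs T"
        by (intro poly_funs_intros Q(1) P(1) poly_funs.coord c)
      show "y \<in> Abstract_Topology.closure_of (zariski T) (h ` points S)"
        using y by (simp add: V_def Y_def)
      fix z assume "z \<in> h ` points S"
      then obtain x where x: "x \<in> points S" "z = h x" by blast
      then have "h x \<in> points T" using h(1) by blast
      with x show "Q z * (P z - c z * Q z ^ k) = 0"
        using P(2)[of "h x"] gh[of x] q(2) by (cases "Q z = 0") auto
    qed
    then have "P y = c y * Q y ^ k" using y by (auto simp: V_def)
    moreover have "P y = c (h (g y)) * Q y ^ k"
      using P(2)[OF yT] y q(2) g(1)[OF yT] by (auto simp: V_def)
    ultimately show "c (h (g y)) = c y" using y by (auto simp: V_def)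
  qed
  have gVU: "g y \<in> U" if "y \<in> V" for y
    using hg[OF that] that YT g(1) by (auto simp: U_def V_def)
  have hUV: "h ` U \<subseteq> V" using hY by (auto simp: U_def V_def)
  have "regular_map T V S U g"
    unfolding regular_map_def
  proof (intro conjI ballI)
    fix c assume "c \<in> coords S"
    then obtain P where P: "P \<in> poly_funs T" "\<forall>y\<in>points T. Q y \<noteq> 0 \<longrightarrow> c (g y) * Q y = P y"
      using g(2) by blast
    show "regular_function T V (c \<circ> g)"
      unfolding regular_function_def
    proof
      fix x assume "x \<in> V"
      have "openin (subtopology (zariski T) V) V"
        using YT by (auto simp: openin_subtopology_refl V_def)
      moreover have "\<forall>y\<in>V. Q y \<noteq> 0 \<and> (c \<circ> g) y = P y / Q y"
        using P(2) YT by (auto simp: V_def field_simps)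
      ultimately show "\<exists>W. openin (subtopology (zariski T) V) W \<and> x \<in> W \<and>
          (\<exists>p\<in>poly_funs T. \<exists>q\<in>poly_funs T. \<forall>y\<in>W. q y \<noteq> 0 \<and> (c \<circ> g) y = p y / q y)"
        using \<open>x \<in> V\<close> P(1) Q(1) by blast
    qed
  qed (use gVU in auto)
  moreover have "regular_map S U T V h" using hUV by (intro reg_h) (auto simp: U_def)
  ultimately have iso: "variety_iso S U T V h"
    unfolding variety_iso_def using hg gh by (auto simp: U_def)
  obtain Q' where Q': "Q' \<in> poly_funs S" "\<forall>x\<in>points S. Q (h x) = Q' x"
    using poly_funs_compose_on_points[where h = h, OF Q(1) h(2)] by blast
  have "U = points S - zero_locus S {Q'}" using Q'(2) by (auto simp: U_def zero_locus_def)
  then have "openin (zariski S) U" unfolding openin_zariski using Q'(1) by blast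
  then have oU: "openin (subtopology (zariski S) (points S)) U"
    using subtopology_topspace[of "zariski S"] by simp
  have "openin (zariski T) (points T - zero_locus T {Q})"
    unfolding openin_zariski using Q(1) by blast
  moreover have "V = (points T - zero_locus T {Q}) \<inter> Y"
    using YT by (auto simp: V_def zero_locus_def)
  ultimately have oV: "openin (subtopology (zariski T) Y) V" unfolding openin_subtopology by blast
  have neU: "U \<noteq> {}" using Q(2) by (auto simp: U_def)
  then have "V \<noteq> {}" using hUV by blast
  then have "birational_morphism S (points S) T Y h"
    unfolding birational_morphism_def
    using iso oU oV neU affine_variety_points[OF S ne] reg_h[OF subset_refl hY]
      affine_variety_closure_of_image[OF S ne h] by (auto simp: Y_def)
  then show ?thesis unfolding birational_onto_image_def Y_def using h(1) by blast
qed

section \<open>Elementary symmetric functions\<close>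

definition esym :: "'i set \<Rightarrow> nat \<Rightarrow> ('i \<Rightarrow> complex) \<Rightarrow> complex" where
  "esym I k y = coeff (\<Prod>i\<in>I. [:1, y i:]) k"

lemma esym_0 [simp]: "esym I 0 y = 1"
proof -
  have "esym I 0 y = poly (\<Prod>i\<in>I. [:1, y i:]) 0" by (simp add: esym_def poly_0_coeff_0)
  then show ?thesis by (simp add: poly_prod)
qed

lemma esym_empty: "esym {} (Suc k) y = 0"
  by (simp add: esym_def)

lemma esym_insert:
  assumes "finite I" "i \<notin> I"
  shows "esym (insert i I) (Suc k) y = esym I (Suc k) y + y i * esym I k y"
  using assms by (simp add: esym_def)

lemma esym_eq_0: "finite I \<Longrightarrow> card I < k \<Longrightarrow> esym I k y = 0"
proof (induction I arbitrary: k rule: finite_induct)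
  case empty
  then show ?case by (cases k) (auto simp: esym_empty)
next
  case (insert i I)
  then show ?case by (cases k) (auto simp: esym_insert)
qed

lemma esym_card: "finite I \<Longrightarrow> esym I (card I) y = (\<Prod>i\<in>I. y i)"
  by (induction I rule: finite_induct) (auto simp: esym_insert esym_eq_0)

lemma esym_1: "finite I \<Longrightarrow> esym I (Suc 0) y = (\<Sum>i\<in>I. y i)"
  by (induction I rule: finite_induct) (auto simp: esym_insert esym_empty)

lemma esym_scale: "finite I \<Longrightarrow> esym I k (\<lambda>i. t * y i) = t ^ k * esym I k y"
proof (induction I arbitrary: k rule: finite_induct)
  case empty
  then show ?case by (cases k) (auto simp: esym_empty)
next
  case (insert i I)
  then show ?case by (cases k) (auto simp: esym_insert algebra_simps)
qed

lemma esym_cong: "(\<And>i. i \<in> I \<Longrightarrow> y i = z i) \<Longrightarrow> esym I k y = esym I k z"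
  unfolding esym_def by (rule arg_cong[where f = "\<lambda>p. coeff p k"], rule prod.cong) auto

lemma esym_Un:
  assumes "finite I" "finite J" "I \<inter> J = {}"
  shows "esym (I \<union> J) k y = (\<Sum>j\<le>k. esym I j y * esym J (k - j) y)"
  using assms by (simp add: esym_def prod.union_disjoint coeff_mult)

lemma esym_subset:
  assumes "finite J" "I \<subseteq> J" "\<And>i. i \<in> J - I \<Longrightarrow> y i = 0"
  shows "esym J k y = esym I k y"
proof -
  have "(\<Prod>i\<in>J. [:1, y i:]) = (\<Prod>i\<in>I. [:1, y i:])"
    by (rule prod.mono_neutral_right) (use assms in auto)
  then show ?thesis by (simp add: esym_def)
qed

lemma esym_permutes:
  assumes "\<sigma> permutes I"
  shows "esym I k (\<lambda>i. y (\<sigma> i)) = esym I k y"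
proof -
  have "(\<Prod>i\<in>I. [:1, y (\<sigma> i):]) = (\<Prod>i\<in>I. [:1, y i:])"
    using prod.permute[OF assms, of "\<lambda>i. [:1, y i:]"] by (simp add: comp_def)
  then show ?thesis by (simp add: esym_def)
qed

lemma poly_funs_esym:
  assumes "finite I" "\<And>i. i \<in> I \<Longrightarrow> (\<lambda>x. y x i) \<in> poly_funs S"
  shows "(\<lambda>x. esym I k (y x)) \<in> poly_funs S"
  using assms
proof (induction I arbitrary: k rule: finite_induct)
  case empty
  then show ?case by (cases k) (auto simp: esym_empty intro: poly_funs.const)
next
  case (insert i I)
  then show ?case by (cases k) (auto simp: esym_insert intro!: poly_funs_intros)
qed

text \<open>
  Factor the monic polynomial whose other coefficients are the prescribed values, from the top
  degree downwards; reversing it turns the roots into factors of the form \<open>1 + y X\<close>.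
\<close>

lemma esym_surj: "\<exists>x. \<forall>k\<in>{1..n}. esym {..<n} k x = c k"
proof -
  define q where "q = monom 1 n + (\<Sum>i<n. monom (c (n - i)) i)"
  have cq: "coeff q i = (if i = n then 1 else if i < n then c (n - i) else 0)" for i
    unfolding q_def by (auto simp: coeff_sum sum.delta')
  have "degree q \<le> n" by (rule degree_le) (auto simp: cq)
  moreover have "n \<le> degree q" by (rule le_degree) (simp add: cq)
  ultimately have deg: "degree q = n" by simp
  then have lc: "lead_coeff q = 1" by (simp add: cq)
  then have "q \<noteq> 0" by auto
  obtain M where M: "size M = n" "q = (\<Prod>a\<in>#M. [:-a, 1:])"
    using alg_closed_imp_factorization[OF \<open>q \<noteq> 0\<close>] deg lc by auto
  obtain xs where xs: "mset xs = M" using ex_mset by blast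
  have len: "length xs = n" using xs M(1) by auto
  have "q = (\<Prod>a\<leftarrow>xs. [:-a, 1:])" unfolding M(2) xs[symmetric]
    by (metis mset_map prod_mset_prod_list)
  also have "\<dots> = (\<Prod>i<n. [:-(xs ! i), 1:])"
    by (simp add: prod.list_conv_set_nth len atLeast0LessThan)
  finally have "reflect_poly q = (\<Prod>i<n. reflect_poly [:-(xs ! i), 1:])"
    by (simp add: reflect_poly_prod)
  also have "\<dots> = (\<Prod>i<n. [:1, -(xs ! i):])"
    by (rule prod.cong) (auto simp: reflect_poly_def cCons_def)
  finally have *: "esym {..<n} k (\<lambda>i. -(xs ! i)) = coeff (reflect_poly q) k" for k
    by (simp add: esym_def)
  then have "esym {..<n} k (\<lambda>i. -(xs ! i)) = c k" if "k \<in> {1..n}" for k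
  proof -
    have "n - k \<noteq> n" "n - k < n" "n - (n - k) = k" "\<not> n < k" using that by auto
    then show ?thesis using * by (simp add: coeff_reflect_poly deg cq)
  qed
  then show ?thesis by blast
qed

text \<open>
  Newton's identities, from the logarithmic derivative of \<open>\<Prod>i\<in>I. 1 + y i X\<close>: dividing the
  product by one of its factors gives the polynomial \<open>\<Sum>k. (\<Sum>j\<le>k. (- y i) ^ j * e (k - j)) X ^ k\<close>.
\<close>

lemma coeff_divided_by_factor:
  fixes P R :: "complex poly"
  assumes "P = [:1, a:] * R"
  shows "coeff R k = (\<Sum>j\<le>k. (- a) ^ j * coeff P (k - j))"
proof (induction k)
  case 0
  then show ?case using assms by simp
next
  case (Suc k)
  have "coeff P (Suc k) = coeff R (Suc k) + a * coeff R k" using assms by simp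
  then have "coeff R (Suc k) = coeff P (Suc k) - a * (\<Sum>j\<le>k. (- a) ^ j * coeff P (k - j))"
    using Suc.IH by simp
  then show ?case
    by (subst sum.atMost_Suc_shift) (simp add: sum_distrib_left algebra_simps sum_negf)
qed

lemma newton_identity:
  assumes "finite I"
  shows "of_nat (Suc k) * esym I (Suc k) y =
    (\<Sum>j\<le>k. (- 1) ^ j * (\<Sum>i\<in>I. y i ^ Suc j) * esym I (k - j) y)"
proof -
  let ?P = "\<Prod>i\<in>I. [:1, y i:]"
  have "pderiv ?P = (\<Sum>i\<in>I. (\<Prod>l\<in>I - {i}. [:1, y l:]) * [:y i:])"
    by (simp add: pderiv_prod pderiv_pCons)
  moreover have "of_nat (Suc k) * esym I (Suc k) y = coeff (pderiv ?P) k"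
    by (simp add: esym_def coeff_pderiv)
  ultimately have "of_nat (Suc k) * esym I (Suc k) y =
      (\<Sum>i\<in>I. y i * coeff (\<Prod>l\<in>I - {i}. [:1, y l:]) k)"
    by (simp add: coeff_sum)
  also have "\<dots> = (\<Sum>i\<in>I. y i * (\<Sum>j\<le>k. (- y i) ^ j * esym I (k - j) y))"
  proof (rule sum.cong[OF refl])
    fix i assume "i \<in> I"
    then have "?P = [:1, y i:] * (\<Prod>l\<in>I - {i}. [:1, y l:])" using assms by (rule prod.remove[rotated])
    from coeff_divided_by_factor[OF this]
    show "y i * coeff (\<Prod>l\<in>I - {i}. [:1, y l:]) k = y i * (\<Sum>j\<le>k. (- y i) ^ j * esym I (k - j) y)"
      by (simp add: esym_def)
  qed
  also have "\<dots> = (\<Sum>i\<in>I. \<Sum>j\<le>k. (- 1) ^ j * y i ^ Suc j * esym I (k - j) y)"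
    by (simp add: sum_distrib_left power_minus[of "y _"] mult_ac)
  also have "\<dots> = (\<Sum>j\<le>k. \<Sum>i\<in>I. (- 1) ^ j * y i ^ Suc j * esym I (k - j) y)"
    by (rule sum.swap)
  also have "\<dots> = (\<Sum>j\<le>k. (- 1) ^ j * (\<Sum>i\<in>I. y i ^ Suc j) * esym I (k - j) y)"
    by (simp only: sum_distrib_left sum_distrib_right)
  finally show ?thesis .
qed

text \<open>The entry \<open>p j\<close> stands for the power sum of exponent \<open>j + 1\<close>.\<close>

fun esym_of_power_sums :: "nat \<Rightarrow> (nat \<Rightarrow> complex) \<Rightarrow> complex" where
  "esym_of_power_sums 0 p = 1"
| "esym_of_power_sums (Suc k) p =
    (\<Sum>j\<le>k. (- 1) ^ j * p j * esym_of_power_sums (k - j) p) / of_nat (Suc k)"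

lemma esym_of_power_sums:
  assumes "finite I" "\<And>j. j < k \<Longrightarrow> p j = (\<Sum>i\<in>I. y i ^ Suc j)"
  shows "esym_of_power_sums k p = esym I k y"
  using assms(2)
proof (induction k rule: less_induct)
  case (less k)
  show ?case
  proof (cases k)
    case (Suc l)
    have "esym_of_power_sums k p =
        (\<Sum>j\<le>l. (- 1) ^ j * (\<Sum>i\<in>I. y i ^ Suc j) * esym I (l - j) y) / of_nat (Suc l)"
      unfolding Suc esym_of_power_sums.simps
      by (rule arg_cong2[where f = "(/)", OF sum.cong[OF refl] refl])
        (use less.prems less.IH Suc in \<open>simp del: power_Suc\<close>)
    also have "\<dots> = esym I k y"
      unfolding newton_identity[OF assms(1), symmetric] Suc by (simp del: of_nat_Suc)
    finally show ?thesis .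
  qed simp
qed

lemma poly_funs_esym_of_power_sums:
  assumes "\<And>j. j < k \<Longrightarrow> (\<lambda>x. p x j) \<in> poly_funs S"
  shows "(\<lambda>x. esym_of_power_sums k (p x)) \<in> poly_funs S"
  using assms
proof (induction k rule: less_induct)
  case (less k)
  show ?case
  proof (cases k)
    case (Suc l)
    have "(\<lambda>x. esym_of_power_sums k (p x)) =
      (\<lambda>x. (1 / of_nat (Suc l)) * (\<Sum>j\<le>l. (- 1) ^ j * p x j * esym_of_power_sums (l - j) (p x)))"
      by (simp add: Suc)
    also have "\<dots> \<in> poly_funs S"
      by (intro poly_funs_intros less) (use Suc less.prems in auto)
    finally show ?thesis .
  qed (auto intro: poly_funs.const)
qed

section \<open>Linear dependence and monomials\<close>

lemma more_unknowns_than_equations: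
  fixes a :: "'i \<Rightarrow> 'j \<Rightarrow> complex"
  assumes "finite J" "finite I" "card J < card I"
  shows "\<exists>x. (\<exists>i\<in>I. x i \<noteq> 0) \<and> (\<forall>j\<in>J. (\<Sum>i\<in>I. x i * a i j) = 0)"
  using assms
proof (induction J arbitrary: I a rule: finite_induct)
  case empty
  then show ?case by (intro exI[of _ "\<lambda>_. 1"]) (auto simp: card_gt_0_iff)
next
  case (insert j J)
  show ?case
  proof (cases "\<forall>i\<in>I. a i j = 0")
    case True
    then show ?thesis using insert.IH[of I a] insert.prems insert.hyps by auto
  next
    case False
    then obtain i0 where i0: "i0 \<in> I" "a i0 j \<noteq> 0" by blast
    have "card J < card (I - {i0})" using insert.prems insert.hyps i0 by simp
    then obtain x where x: "\<exists>i\<in>I - {i0}. x i \<noteq> 0"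
      "\<And>l. l \<in> J \<Longrightarrow> (\<Sum>i\<in>I - {i0}. x i * (a i l - a i j / a i0 j * a i0 l)) = 0"
      using insert.IH[of "I - {i0}" "\<lambda>i l. a i l - a i j / a i0 j * a i0 l"] insert.prems by auto
    \<comment> \<open>The unknown \<open>i0\<close> is eliminated with equation \<open>j\<close>; \<open>s\<close> determines its value afterwards.\<close>
    define s where "s = (\<Sum>i\<in>I - {i0}. x i * a i j)"
    have eq: "(\<Sum>i\<in>I. (x(i0 := - s / a i0 j)) i * a i l) =
        (\<Sum>i\<in>I - {i0}. x i * a i l) - s / a i0 j * a i0 l" for l
      using insert.prems(1) i0(1) by (subst sum.remove[of I i0]) (auto intro!: sum.cong)
    have "(\<Sum>i\<in>I. (x(i0 := - s / a i0 j)) i * a i l) = 0" if "l \<in> insert j J" for l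
    proof (cases "l = j")
      case True
      then show ?thesis unfolding eq unfolding s_def using i0 by simp
    next
      case False
      then have "l \<in> J" using that by simp
      have "(\<Sum>i\<in>I - {i0}. x i * a i l) - s / a i0 j * a i0 l =
          (\<Sum>i\<in>I - {i0}. x i * (a i l - a i j / a i0 j * a i0 l))"
        by (simp add: s_def algebra_simps sum_subtractf sum_distrib_left sum_divide_distrib)
      then show ?thesis unfolding eq using x(2)[OF \<open>l \<in> J\<close>] by simp
    qed
    moreover have "\<exists>i\<in>I. (x(i0 := - s / a i0 j)) i \<noteq> 0" using x(1) by auto
    ultimately show ?thesis by blast
  qed
qed

definition lin_comb :: "('j \<Rightarrow> 'x \<Rightarrow> complex) \<Rightarrow> 'j set \<Rightarrow> ('x \<Rightarrow> complex) set" where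
  "lin_comb G J = {f. \<exists>c. \<forall>x. f x = (\<Sum>j\<in>J. c j * G j x)}"

lemma lin_comb_base:
  assumes "finite J" "j \<in> J"
  shows "G j \<in> lin_comb G J"
proof -
  have "(\<Sum>i\<in>J. (if i = j then 1 else 0) * G i x) = (\<Sum>i\<in>J. if i = j then G j x else 0)" for x
    by (rule sum.cong) auto
  then have "\<forall>x. G j x = (\<Sum>i\<in>J. (if i = j then 1 else 0) * G i x)" using assms by simp
  then show ?thesis
    unfolding lin_comb_def by (intro CollectI exI[of _ "\<lambda>i. if i = j then 1 else 0"])
qed

lemma lin_comb_0: "(\<lambda>_. 0) \<in> lin_comb G J"
  unfolding lin_comb_def by (intro CollectI exI[of _ "\<lambda>_. 0"]) auto

lemma lin_comb_add:
  assumes "f \<in> lin_comb G J" "g \<in> lin_comb G J"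
  shows "(\<lambda>x. f x + g x) \<in> lin_comb G J"
proof -
  obtain c d where "\<forall>x. f x = (\<Sum>j\<in>J. c j * G j x)" "\<forall>x. g x = (\<Sum>j\<in>J. d j * G j x)"
    using assms unfolding lin_comb_def by blast
  then show ?thesis
    unfolding lin_comb_def
    by (intro CollectI exI[of _ "\<lambda>j. c j + d j"]) (auto simp: algebra_simps sum.distrib)
qed

lemma lin_comb_cmult:
  assumes "f \<in> lin_comb G J"
  shows "(\<lambda>x. a * f x) \<in> lin_comb G J"
proof -
  obtain c where "\<forall>x. f x = (\<Sum>j\<in>J. c j * G j x)"
    using assms unfolding lin_comb_def by blast
  then show ?thesis
    unfolding lin_comb_def
    by (intro CollectI exI[of _ "\<lambda>j. a * c j"]) (auto simp: algebra_simps sum_distrib_left)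
qed

lemma lin_comb_sum:
  assumes "\<And>i. i \<in> I \<Longrightarrow> f i \<in> lin_comb G J"
  shows "(\<lambda>x. \<Sum>i\<in>I. f i x) \<in> lin_comb G J"
  using assms
  by (induction I rule: infinite_finite_induct) (auto intro: lin_comb_add lin_comb_0)

lemma lin_comb_mult:
  assumes f: "f \<in> lin_comb G J" and g: "g \<in> lin_comb G K"
    and "\<And>j k. j \<in> J \<Longrightarrow> k \<in> K \<Longrightarrow> (\<lambda>x. G j x * G k x) \<in> lin_comb G L"
  shows "(\<lambda>x. f x * g x) \<in> lin_comb G L"
proof -
  obtain c where c: "\<And>x. f x = (\<Sum>j\<in>J. c j * G j x)" using f unfolding lin_comb_def by blast
  obtain d where d: "\<And>x. g x = (\<Sum>k\<in>K. d k * G k x)" using g unfolding lin_comb_def by blast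
  have "(\<lambda>x. f x * g x) = (\<lambda>x. \<Sum>j\<in>J. \<Sum>k\<in>K. (c j * d k) * (G j x * G k x))"
    unfolding c d sum_product by (simp add: mult_ac)
  also have "\<dots> \<in> lin_comb G L" by (intro lin_comb_sum lin_comb_cmult assms(3))
  finally show ?thesis .
qed

lemma linear_dependence:
  assumes "finite J" "finite I" "card J < card I" "\<And>i. i \<in> I \<Longrightarrow> F i \<in> lin_comb G J"
  obtains x where "\<exists>i\<in>I. x i \<noteq> 0" "\<And>z. (\<Sum>i\<in>I. x i * F i z) = 0"
proof -
  have "\<forall>i\<in>I. \<exists>a. \<forall>z. F i z = (\<Sum>j\<in>J. a j * G j z)"
    using assms(4) unfolding lin_comb_def by blast
  then obtain a where a: "\<And>i z. i \<in> I \<Longrightarrow> F i z = (\<Sum>j\<in>J. a i j * G j z)" by metis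
  obtain x where x: "\<exists>i\<in>I. x i \<noteq> 0" "\<And>j. j \<in> J \<Longrightarrow> (\<Sum>i\<in>I. x i * a i j) = 0"
    using more_unknowns_than_equations[OF assms(1-3), of a] by blast
  have "(\<Sum>i\<in>I. x i * F i z) = 0" for z
  proof -
    have "(\<Sum>i\<in>I. x i * F i z) = (\<Sum>i\<in>I. \<Sum>j\<in>J. x i * a i j * G j z)"
      by (simp add: a sum_distrib_left mult_ac)
    also have "\<dots> = (\<Sum>j\<in>J. \<Sum>i\<in>I. x i * a i j * G j z)" by (rule sum.swap)
    also have "\<dots> = 0" by (simp add: sum_distrib_right[symmetric] x(2))
    finally show ?thesis .
  qed
  with x(1) show ?thesis by (rule that)
qed

definition monomial :: "'v set \<Rightarrow> ('v \<Rightarrow> nat) \<Rightarrow> ('v \<Rightarrow> complex) \<Rightarrow> complex" where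
  "monomial V \<alpha> x = (\<Prod>v\<in>V. x v ^ \<alpha> v)"

lemma poly_funs_monomial: "monomial V \<alpha> \<in> poly_funs (fun_affine V)"
proof -
  have "monomial V \<alpha> = (\<lambda>x. \<Prod>v\<in>V. x v ^ \<alpha> v)" by (auto simp: monomial_def)
  then show ?thesis by (auto intro!: poly_funs_intros fun_affine_coord)
qed

lemma monomial_add:
  "monomial V (\<lambda>v\<in>V. \<alpha> v + \<beta> v) x = monomial V \<alpha> x * monomial V \<beta> x"
  by (simp add: monomial_def power_add prod.distrib)

text \<open>
  Comparing coefficients with respect to one variable \<open>w\<close> leaves relations between monomials in the
  remaining variables. The exponent vectors are only required to differ on \<open>V\<close>, since the
  induction then keeps them unchanged while \<open>V\<close> shrinks.
\<close>

lemma monomials_independent: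
  assumes "finite V" "finite I" "inj_on (\<lambda>i. restrict (\<alpha> i) V) I"
    and "\<And>x. (\<Sum>i\<in>I. c i * monomial V (\<alpha> i) x) = 0" "i \<in> I"
  shows "c i = 0"
  using assms
proof (induction V arbitrary: I i rule: finite_induct)
  case empty
  then have "I = {i}" by (auto simp: inj_on_def)
  then show ?case using empty.prems(3) by (simp add: monomial_def)
next
  case (insert w V)
  let ?k = "\<alpha> i w"
  let ?I = "{l \<in> I. \<alpha> l w = ?k}"
  show ?case
  proof (rule insert.IH)
    show "finite ?I" "i \<in> ?I" using insert.prems by auto
    show "inj_on (\<lambda>i. restrict (\<alpha> i) V) ?I"
    proof (rule inj_onI)
      fix l l' assume l: "l \<in> ?I" "l' \<in> ?I" "restrict (\<alpha> l) V = restrict (\<alpha> l') V"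
      have "restrict (\<alpha> l) (insert w V) = restrict (\<alpha> l') (insert w V)"
      proof
        fix v show "restrict (\<alpha> l) (insert w V) v = restrict (\<alpha> l') (insert w V) v"
          using l(1,2) fun_cong[OF l(3), of v] by (auto simp: restrict_def split: if_splits)
      qed
      from inj_onD[OF insert.prems(2) this] l show "l = l'" by blast
    qed
  next
    fix x
    \<comment> \<open>With \<open>x\<close> fixed outside \<open>w\<close>, the relation is a polynomial identity in the value at \<open>w\<close>.\<close>
    define P where "P = (\<Sum>l\<in>I. monom (c l * monomial V (\<alpha> l) x) (\<alpha> l w))"
    have "poly P t = 0" for t
    proof -
      have "monomial (insert w V) (\<alpha> l) (x(w := t)) = t ^ \<alpha> l w * monomial V (\<alpha> l) x" for l
      proof -
        have "(\<Prod>v\<in>V. (x(w := t)) v ^ \<alpha> l v) = (\<Prod>v\<in>V. x v ^ \<alpha> l v)"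
          using insert.hyps by (intro prod.cong) auto
        then show ?thesis using insert.hyps by (simp add: monomial_def)
      qed
      then have "poly P t = (\<Sum>l\<in>I. c l * monomial (insert w V) (\<alpha> l) (x(w := t)))"
        by (simp add: P_def poly_sum poly_monom mult_ac)
      then show ?thesis using insert.prems(3) by simp
    qed
    then have "P = 0" using poly_all_0_iff_0 by blast
    then have "coeff P ?k = 0" by simp
    then show "(\<Sum>l\<in>?I. c l * monomial V (\<alpha> l) x) = 0"
      using insert.prems(1) by (simp add: P_def coeff_sum sum.inter_filter)
  qed
qed

section \<open>Bounded bidegree\<close>

definition exponents_le :: "'v set \<Rightarrow> nat \<Rightarrow> ('v \<Rightarrow> nat) set" where
  "exponents_le V k = (\<Pi>\<^sub>E v\<in>V. {..k})"

definition weighted_exponents :: "('v \<Rightarrow> nat) \<Rightarrow> 'v set \<Rightarrow> nat \<Rightarrow> ('v \<Rightarrow> nat) set" where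
  "weighted_exponents w V l = {\<gamma> \<in> \<Pi>\<^sub>E v\<in>V. {..l}. (\<Sum>v\<in>V. w v * \<gamma> v) \<le> l}"

lemma finite_exponents_le [simp]: "finite V \<Longrightarrow> finite (exponents_le V k)"
  by (simp add: exponents_le_def finite_PiE)

lemma finite_weighted_exponents [simp]: "finite V \<Longrightarrow> finite (weighted_exponents w V l)"
  unfolding weighted_exponents_def by (rule finite_subset[of _ "\<Pi>\<^sub>E v\<in>V. {..l}"]) (auto simp: finite_PiE)

text \<open>
  Polynomials of degree at most \<open>k\<close> in each variable of the first block and of total degree at
  most \<open>l\<close> in the second block.
\<close>

definition bidegree_le ::
    "'v set \<Rightarrow> 'w set \<Rightarrow> nat \<Rightarrow> nat \<Rightarrow> (('v \<Rightarrow> complex) \<times> ('w \<Rightarrow> complex) \<Rightarrow> complex) set" where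
  "bidegree_le V W k l =
    lin_comb (\<lambda>(\<alpha>, \<gamma>) (A, x). monomial V \<alpha> A * monomial W \<gamma> x)
      (exponents_le V k \<times> weighted_exponents (\<lambda>_. 1) W l)"

context
  fixes V :: "'v set" and W :: "'w set"
  assumes fin: "finite V" "finite W"
begin

lemma bidegree_le_monomial:
  assumes "\<alpha> \<in> exponents_le V k" "\<gamma> \<in> weighted_exponents (\<lambda>_. 1) W l"
  shows "(\<lambda>(A, x). monomial V \<alpha> A * monomial W \<gamma> x) \<in> bidegree_le V W k l"
proof -
  let ?G = "\<lambda>(\<alpha>, \<gamma>) (A, x). monomial V \<alpha> A * monomial W \<gamma> x"
  have "?G (\<alpha>, \<gamma>) \<in> lin_comb ?G (exponents_le V k \<times> weighted_exponents (\<lambda>_. 1) W l)"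
    by (rule lin_comb_base) (use assms fin in auto)
  then show ?thesis unfolding bidegree_le_def by simp
qed

lemma bidegree_le_mult:
  assumes "f \<in> bidegree_le V W k l" "g \<in> bidegree_le V W k' l'"
  shows "(\<lambda>z. f z * g z) \<in> bidegree_le V W (k + k') (l + l')"
  unfolding bidegree_le_def
proof (rule lin_comb_mult[OF assms[unfolded bidegree_le_def]], clarify)
  fix \<alpha> \<beta> :: "'v \<Rightarrow> nat" and \<gamma> \<delta> :: "'w \<Rightarrow> nat"
  assume *: "\<alpha> \<in> exponents_le V k" "\<beta> \<in> exponents_le V k'"
    "\<gamma> \<in> weighted_exponents (\<lambda>_. 1) W l" "\<delta> \<in> weighted_exponents (\<lambda>_. 1) W l'"
  have "(\<lambda>v\<in>V. \<alpha> v + \<beta> v) \<in> exponents_le V (k + k')"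
    using *(1,2) by (auto simp: exponents_le_def PiE_iff intro: add_mono)
  moreover have "(\<lambda>v\<in>W. \<gamma> v + \<delta> v) \<in> weighted_exponents (\<lambda>_. 1) W (l + l')"
    using *(3,4) by (auto simp: weighted_exponents_def PiE_iff sum.distrib intro: add_mono)
  ultimately have "(\<lambda>(A, x). monomial V (\<lambda>v\<in>V. \<alpha> v + \<beta> v) A * monomial W (\<lambda>v\<in>W. \<gamma> v + \<delta> v) x)
    \<in> bidegree_le V W (k + k') (l + l')" by (rule bidegree_le_monomial)
  also have "(\<lambda>(A, x). monomial V (\<lambda>v\<in>V. \<alpha> v + \<beta> v) A * monomial W (\<lambda>v\<in>W. \<gamma> v + \<delta> v) x) =
    (\<lambda>z. (case z of (A, x) \<Rightarrow> monomial V \<alpha> A * monomial W \<gamma> x) *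
      (case z of (A, x) \<Rightarrow> monomial V \<beta> A * monomial W \<delta> x))"
    by (auto simp: monomial_add)
  finally show "(\<lambda>z. (case z of (A, x) \<Rightarrow> monomial V \<alpha> A * monomial W \<gamma> x) *
      (case z of (A, x) \<Rightarrow> monomial V \<beta> A * monomial W \<delta> x))
    \<in> lin_comb (\<lambda>(\<alpha>, \<gamma>) (A, x). monomial V \<alpha> A * monomial W \<gamma> x)
      (exponents_le V (k + k') \<times> weighted_exponents (\<lambda>_. 1) W (l + l'))"
    unfolding bidegree_le_def .
qed

lemma bidegree_le_const: "(\<lambda>_. a) \<in> bidegree_le V W k l"
proof -
  have "(\<lambda>(A, x). monomial V (\<lambda>v\<in>V. 0) A * monomial W (\<lambda>v\<in>W. 0) x) \<in> bidegree_le V W k l"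
    by (rule bidegree_le_monomial) (auto simp: exponents_le_def weighted_exponents_def)
  moreover have "(\<lambda>(A, x). monomial V (\<lambda>v\<in>V. 0) A * monomial W (\<lambda>v\<in>W. 0) x) = (\<lambda>_. 1)"
    by (auto simp: monomial_def)
  ultimately have "(\<lambda>_. 1) \<in> bidegree_le V W k l" by simp
  from lin_comb_cmult[OF this[unfolded bidegree_le_def], of a] show ?thesis
    by (simp add: bidegree_le_def)
qed

lemma bidegree_le_mono:
  assumes "f \<in> bidegree_le V W k l" "k \<le> k'" "l \<le> l'"
  shows "f \<in> bidegree_le V W k' l'"
  using bidegree_le_mult[OF assms(1) bidegree_le_const[of 1 "k' - k" "l' - l"]] assms(2,3) by simp

lemma bidegree_le_add:
  "f \<in> bidegree_le V W k l \<Longrightarrow> g \<in> bidegree_le V W k l \<Longrightarrow> (\<lambda>z. f z + g z) \<in> bidegree_le V W k l"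
  unfolding bidegree_le_def by (rule lin_comb_add)

lemma bidegree_le_sum:
  "(\<And>i. i \<in> I \<Longrightarrow> f i \<in> bidegree_le V W k l) \<Longrightarrow> (\<lambda>z. \<Sum>i\<in>I. f i z) \<in> bidegree_le V W k l"
  unfolding bidegree_le_def by (rule lin_comb_sum)

lemma bidegree_le_power:
  "f \<in> bidegree_le V W k l \<Longrightarrow> (\<lambda>z. f z ^ j) \<in> bidegree_le V W (j * k) (j * l)"
  by (induction j) (auto intro: bidegree_le_const bidegree_le_mult)

lemma bidegree_le_prod:
  "(\<And>i. i \<in> I \<Longrightarrow> f i \<in> bidegree_le V W (k i) (l i)) \<Longrightarrow>
    (\<lambda>z. \<Prod>i\<in>I. f i z) \<in> bidegree_le V W (\<Sum>i\<in>I. k i) (\<Sum>i\<in>I. l i)"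
  by (induction I rule: infinite_finite_induct) (auto intro: bidegree_le_const bidegree_le_mult)

lemma bidegree_le_fst:
  assumes "v \<in> V"
  shows "(\<lambda>z. fst z v) \<in> bidegree_le V W 1 0"
proof -
  have "(\<lambda>(A, x). monomial V (\<lambda>u\<in>V. if u = v then 1 else 0) A * monomial W (\<lambda>v\<in>W. 0) x)
      \<in> bidegree_le V W 1 0"
    by (rule bidegree_le_monomial) (auto simp: exponents_le_def weighted_exponents_def)
  moreover have "(\<Prod>u\<in>V. A u ^ (if u = v then 1 else 0)) = A v" for A :: "'v \<Rightarrow> complex"
    using assms fin by (simp add: if_distrib cong: if_cong)
  ultimately show ?thesis by (simp add: monomial_def case_prod_unfold)
qed

lemma bidegree_le_snd:
  assumes "w \<in> W"
  shows "(\<lambda>z. snd z w) \<in> bidegree_le V W 0 1"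
proof -
  have "(\<Sum>u\<in>W. 1 * (\<lambda>u\<in>W. if u = w then 1 else 0 :: nat) u) = (\<Sum>u\<in>W. if u = w then 1 else 0)"
    by (rule sum.cong) auto
  then have "(\<lambda>(A, x). monomial V (\<lambda>v\<in>V. 0) A * monomial W (\<lambda>u\<in>W. if u = w then 1 else 0) x)
      \<in> bidegree_le V W 0 1"
    by (intro bidegree_le_monomial) (use assms fin in \<open>auto simp: exponents_le_def weighted_exponents_def\<close>)
  moreover have "(\<Prod>u\<in>W. x u ^ (if u = w then 1 else 0)) = x w" for x :: "'w \<Rightarrow> complex"
    using assms fin by (simp add: if_distrib cong: if_cong)
  ultimately show ?thesis by (simp add: monomial_def case_prod_unfold)
qed

lemma bidegree_le_monomial_fst:
  assumes "\<alpha> \<in> exponents_le V k"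
  shows "(\<lambda>z. monomial V \<alpha> (fst z)) \<in> bidegree_le V W k 0"
proof -
  have "(\<lambda>(A, x). monomial V \<alpha> A * monomial W (\<lambda>v\<in>W. 0) x) \<in> bidegree_le V W k 0"
    by (rule bidegree_le_monomial) (use assms in \<open>auto simp: weighted_exponents_def\<close>)
  then show ?thesis by (simp add: monomial_def case_prod_unfold)
qed

end

section \<open>Counting exponents\<close>

text \<open>
  Otherwise \<open>f\<close> would grow exponentially along the multiples of \<open>s\<close>.
\<close>

lemma polynomial_growth_ratio:
  fixes f :: "nat \<Rightarrow> nat"
  assumes "N > 0" "f 0 > 0" "\<And>l. f l \<le> (l + 1) ^ p"
  shows "\<exists>d. N * f (d + s) < (N + 1) * f d"
proof (rule ccontr)
  assume "\<not> ?thesis"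
  then have step: "(N + 1) * f d \<le> N * f (d + s)" for d by (simp add: not_less)
  have iterate: "(N + 1) ^ j * f 0 \<le> N ^ j * f (j * s)" for j
  proof (induction j)
    case (Suc j)
    have "(N + 1) ^ Suc j * f 0 = (N + 1) * ((N + 1) ^ j * f 0)" by (simp only: power_Suc mult.assoc)
    also have "\<dots> \<le> (N + 1) * (N ^ j * f (j * s))" using Suc by (rule mult_le_mono2)
    also have "\<dots> = N ^ j * ((N + 1) * f (j * s))" by (simp only: mult_ac)
    also have "\<dots> \<le> N ^ j * (N * f (j * s + s))" using step by (intro mult_left_mono) auto
    finally show ?case by (simp add: algebra_simps)
  qed simp
  have le_nat: "(N + 1) ^ j \<le> N ^ j * (j * s + 1) ^ p" for j
  proof -
    have "(N + 1) ^ j \<le> (N + 1) ^ j * f 0" using assms(2) by simp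
    also have "\<dots> \<le> N ^ j * f (j * s)" by (rule iterate)
    also have "\<dots> \<le> N ^ j * (j * s + 1) ^ p" by (intro mult_le_mono2 assms(3))
    finally show ?thesis .
  qed
  have le: "real (N + 1) ^ j \<le> real N ^ j * real (j * s + 1) ^ p" for j
    using le_nat[of j] by (metis of_nat_le_iff of_nat_mult of_nat_power)
  \<comment> \<open>Taking roots turns the claim into: \<open>q ^ j\<close> is not bounded by a linear function of \<open>j\<close>. The
    exponent \<open>Suc p\<close> instead of \<open>p\<close> keeps the root meaningful for \<open>p = 0\<close>.\<close>
  define q where "q = root (Suc p) (real (N + 1) / real N)"
  have q: "q > 1" using assms(1) by (simp add: q_def)
  have q_pow: "q ^ Suc p = real (N + 1) / real N" using assms(1) by (simp add: q_def del: power_Suc)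
  have ge: "q ^ j \<le> real (j * s + 1)" for j
  proof (rule power_le_imp_le_base)
    have "(q ^ j) ^ Suc p = (real (N + 1) / real N) ^ j"
      unfolding q_pow[symmetric] by (simp only: power_mult[symmetric] mult.commute)
    also have "\<dots> \<le> real (j * s + 1) ^ p"
      using le[of j] assms(1) by (simp add: power_divide divide_simps mult_ac)
    also have "\<dots> \<le> real (j * s + 1) ^ Suc p" by (rule power_increasing) auto
    finally show "(q ^ j) ^ Suc p \<le> real (j * s + 1) ^ Suc p" .
  qed simp
  have "(\<lambda>j. real s * (real j * (1 / q) ^ j) + (1 / q) ^ j) \<longlonglongrightarrow> real s * 0 + 0"
    using q by (intro tendsto_intros powser_times_n_limit_0 LIMSEQ_realpow_zero) auto
  moreover have "real s * (real j * (1 / q) ^ j) + (1 / q) ^ j = real (j * s + 1) / q ^ j" for j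
    using q by (simp add: field_simps)
  ultimately have "(\<lambda>j. real (j * s + 1) / q ^ j) \<longlonglongrightarrow> 0" by simp
  moreover have "1 \<le> real (j * s + 1) / q ^ j" for j using ge[of j] q by (simp add: le_divide_eq)
  ultimately have "1 \<le> (0::real)" by (intro tendsto_lowerbound) auto
  then show False by simp
qed

lemma card_exponents_le:
  assumes "finite V"
  shows "card (exponents_le V k) = (k + 1) ^ card V"
  using assms by (simp add: exponents_le_def card_PiE)

text \<open>
  Splitting each exponent \<open>\<gamma> k\<close> into quotient and remainder modulo the weight \<open>k + 1\<close> shows that
  weighting divides the number of exponents by at most \<open>fact n\<close>, the number of remainders.
\<close>

lemma card_simplex_le_weighted:
  "card (weighted_exponents (\<lambda>_. 1) {..<n} l) \<le> fact n * card (weighted_exponents Suc {..<n} l)"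
proof -
  define R where "R = (\<Pi>\<^sub>E k\<in>{..<n}. {..<Suc k})"
  define \<phi> where "\<phi> \<gamma> = (\<lambda>k\<in>{..<n}. \<gamma> k mod Suc k, \<lambda>k\<in>{..<n}. \<gamma> k div Suc k)" for \<gamma> :: "nat \<Rightarrow> nat"
  have "card (weighted_exponents (\<lambda>_. 1) {..<n} l) \<le> card (R \<times> weighted_exponents Suc {..<n} l)"
  proof (rule card_inj_on_le)
    show "inj_on \<phi> (weighted_exponents (\<lambda>_. 1) {..<n} l)"
    proof (rule inj_onI)
      fix \<gamma> \<delta> assume *: "\<gamma> \<in> weighted_exponents (\<lambda>_. 1) {..<n} l"
        "\<delta> \<in> weighted_exponents (\<lambda>_. 1) {..<n} l" "\<phi> \<gamma> = \<phi> \<delta>"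
      show "\<gamma> = \<delta>"
      proof (rule PiE_ext)
        show "\<gamma> \<in> (\<Pi>\<^sub>E v\<in>{..<n}. {..l})" "\<delta> \<in> (\<Pi>\<^sub>E v\<in>{..<n}. {..l})"
          using * by (auto simp: weighted_exponents_def)
        fix k assume k: "k \<in> {..<n}"
        have "\<gamma> k mod Suc k = \<delta> k mod Suc k" "\<gamma> k div Suc k = \<delta> k div Suc k"
          using * k unfolding \<phi>_def by (auto simp: restrict_def fun_eq_iff split: if_splits)
        then show "\<gamma> k = \<delta> k" by (metis div_mult_mod_eq)
      qed
    qed
    show "\<phi> ` weighted_exponents (\<lambda>_. 1) {..<n} l \<subseteq> R \<times> weighted_exponents Suc {..<n} l"
    proof (rule image_subsetI)
      fix \<gamma> assume \<gamma>: "\<gamma> \<in> weighted_exponents (\<lambda>_. 1) {..<n} l"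
      have "(\<Sum>k<n. Suc k * (\<gamma> k div Suc k)) \<le> (\<Sum>k<n. \<gamma> k)" by (intro sum_mono times_div_less_eq_dividend)
      also have "\<dots> \<le> l" using \<gamma> by (simp add: weighted_exponents_def)
      finally have "(\<Sum>k<n. Suc k * (\<gamma> k div Suc k)) \<le> l" .
      moreover have "\<gamma> k div Suc k \<le> l" if "k < n" for k
      proof -
        have "\<gamma> k \<le> l" using \<gamma> that by (auto simp: weighted_exponents_def PiE_iff)
        then show ?thesis using div_le_dividend le_trans by blast
      qed
      ultimately show "\<phi> \<gamma> \<in> R \<times> weighted_exponents Suc {..<n} l"
        by (auto simp: \<phi>_def R_def weighted_exponents_def)
    qed
    show "finite (R \<times> weighted_exponents Suc {..<n} l)" by (auto simp: R_def finite_PiE)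
  qed
  also have "card R = fact n" by (simp add: R_def card_PiE fact_prod_Suc atLeast0LessThan)
  then have "card (R \<times> weighted_exponents Suc {..<n} l) = fact n * card (weighted_exponents Suc {..<n} l)"
    by (simp add: card_cartesian_product)
  finally show ?thesis .
qed

text \<open>
  The left side counts the monomials \<open>A\<^sup>\<alpha> x\<^sup>\<gamma>\<close> of bounded bidegree, the right side the functions
  \<open>A\<^sup>\<alpha> e\<^sup>\<beta> g\<^sub>r\<close> that are combinations of them, where \<open>g\<^sub>r\<close> has degree at most \<open>s\<close>. The two degrees have to
  be chosen one after the other, since the second one must be large compared with the number of
  exponents for the first.
\<close>

lemma exponent_count:
  assumes "finite V"
  obtains d e where
    "card (exponents_le V (e + (d + s)) \<times> weighted_exponents (\<lambda>_. 1) {..<n} (d + s)) <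
     card (exponents_le V e \<times> weighted_exponents Suc {..<n} d \<times> {..(fact n :: nat)})"
proof -
  let ?N = "fact n :: nat"
  let ?B = "\<lambda>l. card (weighted_exponents (\<lambda>_. 1) {..<n} l)"
  let ?W = "\<lambda>l. card (weighted_exponents Suc {..<n} l)"
  let ?X = "\<lambda>k. card (exponents_le V k)"
  have zero: "(\<lambda>_\<in>{..<n}. 0) \<in> weighted_exponents (\<lambda>_. 1) {..<n} l" for l
    by (auto simp: weighted_exponents_def)
  have B_pos: "?B l > 0" for l using zero[of l] by (auto simp: card_gt_0_iff)
  have "?B l \<le> (l + 1) ^ n" for l
  proof -
    have "?B l \<le> card (\<Pi>\<^sub>E v\<in>{..<n}. {..l})"
      by (rule card_mono) (auto simp: weighted_exponents_def finite_PiE)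
    then show ?thesis by (simp add: card_PiE)
  qed
  then obtain d where "?N * ?B (d + s) < (?N + 1) * ?B d"
    using polynomial_growth_ratio[of ?N ?B n s] B_pos by auto
  also have "\<dots> \<le> (?N + 1) * (?N * ?W d)"
    by (rule mult_left_mono[OF card_simplex_le_weighted]) simp
  finally have "?N * ?B (d + s) < ?N * ((?N + 1) * ?W d)" by (simp only: mult_ac)
  then have d: "?B (d + s) + 1 \<le> (?N + 1) * ?W d" by simp
  obtain e where "?B (d + s) * ?X (e + (d + s)) < (?B (d + s) + 1) * ?X e"
    using polynomial_growth_ratio[of "?B (d + s)" ?X "card V" "d + s"] B_pos
    by (auto simp: card_exponents_le[OF assms])
  also have "\<dots> \<le> (?N + 1) * ?W d * ?X e" using d by (rule mult_right_mono) simp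
  finally have "?X (e + (d + s)) * ?B (d + s) < ?X e * (?W d * (?N + 1))" by (simp only: mult_ac)
  then have "card (exponents_le V (e + (d + s)) \<times> weighted_exponents (\<lambda>_. 1) {..<n} (d + s)) <
     card (exponents_le V e \<times> weighted_exponents Suc {..<n} d \<times> {..?N})"
    by (simp add: card_cartesian_product)
  then show ?thesis by (rule that)
qed

section \<open>Independence of the powers of the last symmetric function\<close>

definition mat_act :: "nat \<Rightarrow> (nat \<times> nat \<Rightarrow> complex) \<Rightarrow> (nat \<Rightarrow> complex) \<Rightarrow> nat \<Rightarrow> complex" where
  "mat_act n A x i = (\<Sum>j<n. A (i, j) * x j)"

definition esym_act ::
    "nat \<Rightarrow> nat \<Rightarrow> (nat \<times> nat \<Rightarrow> complex) \<Rightarrow> (nat \<Rightarrow> complex) \<Rightarrow> nat \<Rightarrow> complex" where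
  "esym_act m n A x k = esym {..<m} (Suc k) (mat_act n A x)"

abbreviation param_affine ::
    "nat \<Rightarrow> nat \<Rightarrow> ((nat \<times> nat \<Rightarrow> complex) \<times> (nat \<Rightarrow> complex)) affine_space" where
  "param_affine m n \<equiv> fun_affine ({..<m} \<times> {..<n}) \<times>\<^sub>A fun_affine {..<n}"

lemma poly_funs_entry: "i < m \<Longrightarrow> j < n \<Longrightarrow> (\<lambda>z. fst z (i, j)) \<in> poly_funs (param_affine m n)"
  by (rule poly_funs_fst, rule fun_affine_coord) auto

lemma poly_funs_arg: "j < n \<Longrightarrow> (\<lambda>z. snd z j) \<in> poly_funs (param_affine m n)"
  by (rule poly_funs_snd, rule fun_affine_coord) auto

lemma curve_connected_param_affine: "curve_connected (param_affine m n)"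
  by (intro curve_connected_prod curve_connected_fun_affine)

abbreviation line_affine :: "complex affine_space" where
  "line_affine \<equiv> \<lparr>points = UNIV, coords = {\<lambda>t. t}\<rparr>"

lemma poly_funs_line_id: "(\<lambda>t. t) \<in> poly_funs line_affine"
  by (rule poly_funs.coord) simp

lemma poly_funs_line:
  assumes "f \<in> poly_funs line_affine"
  shows "\<exists>P. \<forall>t. f t = poly P t"
  using assms by (rule poly_funs_along_curve) (auto intro: exI[of _ "[:0, 1:]"])

text \<open>
  A function that is polynomial in \<open>(t, z)\<close>, ordered by the powers of \<open>t\<close>; the bound on the degree
  is uniform in \<open>z\<close>.
\<close>

definition poly_family :: "'a affine_space \<Rightarrow> ('a \<Rightarrow> complex poly) \<Rightarrow> bool" where
  "poly_family Z F \<longleftrightarrow> (\<forall>k. (\<lambda>z. coeff (F z) k) \<in> poly_funs Z) \<and> (\<exists>K. \<forall>z. degree (F z) \<le> K)"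

lemma poly_family_coeff: "poly_family Z F \<Longrightarrow> (\<lambda>z. coeff (F z) k) \<in> poly_funs Z"
  unfolding poly_family_def by blast

lemma poly_family_const: "poly_family Z (\<lambda>_. p)"
  unfolding poly_family_def by (auto intro: poly_funs.const)

lemma poly_family_linear:
  assumes "a \<in> poly_funs Z" "b \<in> poly_funs Z"
  shows "poly_family Z (\<lambda>z. [:a z, b z:])"
  unfolding poly_family_def
proof (intro conjI allI exI)
  fix k show "(\<lambda>z. coeff [:a z, b z:] k) \<in> poly_funs Z"
    by (cases k; cases "k - 1") (auto intro: assms poly_funs.const)
  fix z show "degree [:a z, b z:] \<le> 1" by simp
qed

lemma poly_family_add:
  assumes "poly_family Z F" "poly_family Z G"
  shows "poly_family Z (\<lambda>z. F z + G z)"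
proof -
  obtain K L where "\<forall>z. degree (F z) \<le> K" "\<forall>z. degree (G z) \<le> L"
    using assms unfolding poly_family_def by blast
  then have "degree (F z + G z) \<le> max K L" for z
    using degree_add_le_max[of "F z" "G z"] by (meson le_max_iff_disj max.mono order_trans)
  then show ?thesis
    unfolding poly_family_def using assms
    by (auto intro!: poly_funs.add poly_family_coeff)
qed

lemma poly_family_mult:
  assumes "poly_family Z F" "poly_family Z G"
  shows "poly_family Z (\<lambda>z. F z * G z)"
proof -
  obtain K L where "\<forall>z. degree (F z) \<le> K" "\<forall>z. degree (G z) \<le> L"
    using assms unfolding poly_family_def by blast
  then have "degree (F z * G z) \<le> K + L" for z
    using degree_mult_le[of "F z" "G z"] by (meson add_mono order_trans)
  then show ?thesis
    unfolding poly_family_def coeff_mult using assms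
    by (auto intro!: poly_funs_intros poly_family_coeff)
qed

lemma poly_family_compose:
  assumes "p \<in> poly_funs S"
    and "\<And>c. c \<in> coords S \<Longrightarrow> \<exists>F. poly_family Z F \<and> (\<forall>t z. c (h t z) = poly (F z) t)"
  shows "\<exists>F. poly_family Z F \<and> (\<forall>t z. p (h t z) = poly (F z) t)"
  using assms(1)
proof induction
  case (coord c)
  then show ?case by (rule assms(2))
next
  case (const a)
  show ?case by (rule exI[of _ "\<lambda>_. [:a:]"]) (auto intro: poly_family_const)
next
  case (add p q)
  then obtain F G where "poly_family Z F" "\<forall>t z. p (h t z) = poly (F z) t"
    "poly_family Z G" "\<forall>t z. q (h t z) = poly (G z) t" by blast
  then show ?case by (intro exI[of _ "\<lambda>z. F z + G z"]) (auto intro: poly_family_add)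
next
  case (mult p q)
  then obtain F G where "poly_family Z F" "\<forall>t z. p (h t z) = poly (F z) t"
    "poly_family Z G" "\<forall>t z. q (h t z) = poly (G z) t" by blast
  then show ?case by (intro exI[of _ "\<lambda>z. F z * G z"]) (auto intro: poly_family_mult)
qed

text \<open>The base point of the degeneration; within \<open>m\<close> rows and \<open>n\<close> columns it is an identity block on
  top of zero rows.\<close>

definition unit_block :: "nat \<times> nat \<Rightarrow> complex" where
  "unit_block ij = (if fst ij = snd ij then 1 else 0)"

lemma mat_act_pencil:
  "mat_act n (\<lambda>ij. unit_block ij + t * B ij) x i = (if i < n then x i else 0) + t * mat_act n B x i"
proof -
  have "(\<Sum>j<n. unit_block (i, j) * x j) = (\<Sum>j<n. if i = j then x j else 0)"
    by (rule sum.cong) (auto simp: unit_block_def)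
  then show ?thesis
    by (simp add: mat_act_def algebra_simps sum.distrib sum_distrib_left)
qed

text \<open>
  Every product of \<open>n + 1\<close> of the entries of the vector contains one of the entries with index at
  least \<open>n\<close>, which are divisible by \<open>t\<close>. The quotient at \<open>t = 0\<close> is the product of all the \<open>x i\<close>
  times the sum of the remaining entries of \<open>B x\<close>, and that linear form is not symmetric in \<open>x\<close>.
\<close>

definition pencil_slope :: "nat \<Rightarrow> nat \<Rightarrow> (nat \<times> nat \<Rightarrow> complex) \<Rightarrow> (nat \<Rightarrow> complex) \<Rightarrow> complex" where
  "pencil_slope m n B x = (\<Prod>i<n. x i) * (\<Sum>i\<in>{n..<m}. mat_act n B x i)"

lemma esym_act_pencil_last:
  assumes "n < m"
  obtains R where "\<And>t. esym_act m n (\<lambda>ij. unit_block ij + t * B ij) x n = t * poly R t"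
    "poly R 0 = pencil_slope m n B x"
proof -
  let ?y = "\<lambda>t. mat_act n (\<lambda>ij. unit_block ij + t * B ij) x"
  let ?b = "mat_act n B x"
  define r where "r t = (\<Sum>j\<le>n. t ^ (n - j) * (esym {..<n} j (?y t) * esym {n..<m} (Suc n - j) ?b))" for t
  have *: "esym_act m n (\<lambda>ij. unit_block ij + t * B ij) x n = t * r t" for t
  proof -
    have "esym {n..<m} k (?y t) = esym {n..<m} k (\<lambda>i. t * ?b i)" for k
      by (rule esym_cong) (simp add: mat_act_pencil)
    then have low: "esym {n..<m} k (?y t) = t ^ k * esym {n..<m} k ?b" for k
      by (simp add: esym_scale)
    have un: "{..<m} = {..<n} \<union> {n..<m}" using assms by auto
    have "esym_act m n (\<lambda>ij. unit_block ij + t * B ij) x n =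
        (\<Sum>j\<le>Suc n. esym {..<n} j (?y t) * esym {n..<m} (Suc n - j) (?y t))"
      unfolding esym_act_def un by (rule esym_Un) auto
    also have "\<dots> = (\<Sum>j\<le>n. esym {..<n} j (?y t) * (t ^ (Suc n - j) * esym {n..<m} (Suc n - j) ?b))"
      by (simp add: low esym_eq_0)
    also have "\<dots> = t * r t"
      unfolding r_def sum_distrib_left by (rule sum.cong) (auto simp: Suc_diff_le)
    finally show ?thesis .
  qed
  have r0: "r 0 = pencil_slope m n B x"
  proof -
    have "r 0 = (\<Sum>j\<le>n. if j = n then esym {..<n} n (?y 0) * esym {n..<m} 1 ?b else 0)"
      unfolding r_def by (rule sum.cong) (auto simp: power_0_left)
    also have "\<dots> = esym {..<n} n (?y 0) * (\<Sum>i\<in>{n..<m}. ?b i)" by (simp add: esym_1)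
    also have "esym {..<n} n (?y 0) = esym {..<n} (card {..<n}) x"
      unfolding card_lessThan by (rule esym_cong) (simp add: mat_act_pencil[of n 0 B, simplified])
    finally show ?thesis using esym_card[of "{..<n}" x] by (simp add: pencil_slope_def)
  qed
  have "(\<lambda>t. ?y t i) \<in> poly_funs line_affine" for i
    unfolding mat_act_pencil by (intro poly_funs_intros poly_funs_line_id)
  then have "r \<in> poly_funs line_affine"
    unfolding r_def by (intro poly_funs_intros poly_funs_line_id poly_funs_esym) auto
  then obtain R where "\<And>t. r t = poly R t" using poly_funs_line by blast
  then show ?thesis using that[of R] * r0 by simp
qed

lemma poly_funs_mat_act:
  assumes "i < m" "\<And>j. j < n \<Longrightarrow> (\<lambda>z. x z j) \<in> poly_funs (param_affine m n)"
  shows "(\<lambda>z. mat_act n (fst z) (x z) i) \<in> poly_funs (param_affine m n)"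
  unfolding mat_act_def using assms by (intro poly_funs_intros poly_funs_entry) auto

text \<open>
  A matrix \<open>B\<close> with a single nonzero entry in row \<open>n\<close> and column \<open>j\<close> makes the slope read off the
  value that the permutation puts in position \<open>j\<close>.
\<close>

lemma pencil_slope_separates:
  assumes "n < m" "\<sigma> permutes {..<n}" "\<tau> permutes {..<n}" "\<sigma> \<noteq> \<tau>"
  shows "\<exists>B x. pencil_slope m n B (\<lambda>i. x (\<sigma> i)) \<noteq> pencil_slope m n B (\<lambda>i. x (\<tau> i))"
proof -
  obtain j where j: "\<sigma> j \<noteq> \<tau> j" using assms(4) by blast
  then have "j < n" using assms(2,3) by (metis lessThan_iff permutes_not_in)
  define x where "x i = (of_nat (Suc i) :: complex)" for i
  define B where "B ij = (if ij = (n, j) then 1 else 0 :: complex)" for ij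
  have "pencil_slope m n B (\<lambda>i. x (\<pi> i)) = (\<Prod>i<n. x i) * x (\<pi> j)" if "\<pi> permutes {..<n}" for \<pi>
  proof -
    have "(\<Prod>i<n. x (\<pi> i)) = (\<Prod>i<n. x i)" using prod.permute[OF that, of x] by (simp add: comp_def)
    moreover have "mat_act n B (\<lambda>i. x (\<pi> i)) i = (if i = n then x (\<pi> j) else 0)" for i
    proof -
      have "mat_act n B (\<lambda>i. x (\<pi> i)) i = (\<Sum>l<n. if l = j then if i = n then x (\<pi> j) else 0 else 0)"
        unfolding mat_act_def B_def by (rule sum.cong) auto
      then show ?thesis using \<open>j < n\<close> by simp
    qed
    ultimately show ?thesis using assms(1) by (simp add: pencil_slope_def)
  qed
  moreover have "(\<Prod>i<n. x i) \<noteq> 0" by (simp add: x_def del: of_nat_Suc)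
  moreover have "x (\<sigma> j) \<noteq> x (\<tau> j)" using j by (simp add: x_def)
  ultimately have "pencil_slope m n B (\<lambda>i. x (\<sigma> i)) \<noteq> pencil_slope m n B (\<lambda>i. x (\<tau> i))"
    using assms(2,3) by simp
  then show ?thesis by blast
qed

lemma poly_funs_fun_affine_cong:
  assumes "p \<in> poly_funs (fun_affine V \<times>\<^sub>A fun_affine W)"
    and "\<And>v. v \<in> V \<Longrightarrow> A v = A' v" "\<And>w. w \<in> W \<Longrightarrow> x w = x' w"
  shows "p (A, x) = p (A', x')"
  using assms(1) by induction (auto simp: prod_affine_def fun_affine_def assms(2,3))

lemma poly_with_low_coeffs_zero:
  fixes p :: "complex poly"
  assumes "degree p \<le> K" "\<And>k. k < l \<Longrightarrow> coeff p k = 0"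
  shows "poly p t = t ^ l * (\<Sum>i\<le>K. coeff p (l + i) * t ^ i)"
proof -
  have "p = (\<Sum>i\<le>K. monom (coeff p (l + i)) (l + i))"
  proof (rule poly_eqI)
    fix k
    have "(\<Sum>i\<le>K. coeff (monom (coeff p (l + i)) (l + i)) k) =
        (\<Sum>i\<le>K. if i = k - l then (if l \<le> k then coeff p k else 0) else 0)"
      by (rule sum.cong) auto
    also have "\<dots> = coeff p k" using assms by (auto intro: coeff_eq_0)
    finally show "coeff p k = coeff (\<Sum>i\<le>K. monom (coeff p (l + i)) (l + i)) k"
      by (simp add: coeff_sum)
  qed
  then have "poly p t = poly (\<Sum>i\<le>K. monom (coeff p (l + i)) (l + i)) t" by simp
  then show ?thesis by (simp add: poly_sum poly_monom power_add sum_distrib_left mult_ac)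
qed

text \<open>
  Substituting the pencil \<open>unit_block + t B\<close> into the relation and dividing by the highest
  possible power of \<open>t\<close> leaves, at \<open>t = 0\<close>, a polynomial in one variable of degree less than
  \<open>fact n\<close>. Its coefficients are symmetric in \<open>x\<close>, so the slopes of all permutations of \<open>x\<close> are
  roots of it; these are more roots than its degree allows.
\<close>

lemma esym_powers_independent:
  fixes M :: "nat \<Rightarrow> (nat \<times> nat \<Rightarrow> complex) \<times> (nat \<Rightarrow> complex) \<Rightarrow> complex"
  assumes nm: "n < m" and M: "\<And>r. r < fact n \<Longrightarrow> M r \<in> poly_funs (param_affine m n)"
    and rel: "\<And>A x. (\<Sum>r<fact n. M r (A, esym_act m n A x) * esym_act m n A x n ^ r) = 0"
    and r: "r < fact n"
  shows "M r (A, c) = 0"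
proof (rule ccontr)
  assume nz: "M r (A, c) \<noteq> 0"
  let ?N = "fact n :: nat" and ?Z = "param_affine m n"
  let ?A = "\<lambda>t B ij. unit_block ij + t * B ij"
  have "\<exists>F. poly_family ?Z F \<and> (\<forall>t z. M r (?A t (fst z), snd z) = poly (F z) t)" if "r < ?N" for r
  proof (rule poly_family_compose[OF M[OF that]])
    fix c assume "c \<in> coords ?Z"
    then consider i j where "i < m" "j < n" "c = (\<lambda>z. fst z (i, j))" | k where "k < n" "c = (\<lambda>z. snd z k)"
      by (auto simp: prod_affine_def fun_affine_def comp_def)
    then show "\<exists>F. poly_family ?Z F \<and> (\<forall>t z. c (?A t (fst z), snd z) = poly (F z) t)"
    proof cases
      case 1
      then show ?thesis
        by (intro exI[of _ "\<lambda>z. [:unit_block (i, j), fst z (i, j):]"])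
          (auto intro!: poly_family_linear poly_funs.const poly_funs_entry)
    next
      case 2
      have "poly_family ?Z (\<lambda>z. [:snd z k, 0:])"
        by (intro poly_family_linear poly_funs_arg poly_funs.const 2)
      then show ?thesis using 2 by (intro exI[of _ "\<lambda>z. [:snd z k, 0:]"]) auto
    qed
  qed
  then have "\<forall>r. \<exists>F. r < ?N \<longrightarrow>
    poly_family ?Z F \<and> (\<forall>t z. M r (?A t (fst z), snd z) = poly (F z) t)" by blast
  then obtain F where "\<forall>r. r < ?N \<longrightarrow>
    poly_family ?Z (F r) \<and> (\<forall>t z. M r (?A t (fst z), snd z) = poly (F r z) t)"
    unfolding choice_iff by (elim exE)
  then have F: "\<And>r. r < ?N \<Longrightarrow> poly_family ?Z (F r)"
    "\<And>r t z. r < ?N \<Longrightarrow> M r (?A t (fst z), snd z) = poly (F r z) t" by blast+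
  \<comment> \<open>The factor \<open>t ^ r\<close> comes from writing the last symmetric function as \<open>t\<close> times its quotient.\<close>
  define G where "G r z = monom 1 r * F r z" for r z
  have G: "poly_family ?Z (G r)" if "r < ?N" for r
    unfolding G_def by (intro poly_family_mult poly_family_const F that)
  have "\<exists>k. \<exists>r<?N. \<exists>z. coeff (G r z) k \<noteq> 0"
  proof -
    let ?z = "(\<lambda>ij. A ij - unit_block ij, c)"
    have "poly (G r ?z) 1 = M r (A, c)" using F(2)[OF r, of 1 ?z] by (simp add: G_def poly_monom)
    then have "G r ?z \<noteq> 0" using nz by auto
    then show ?thesis using r leading_coeff_neq_0 by blast
  qed
  then obtain l where "\<exists>r<?N. \<exists>z. coeff (G r z) l \<noteq> 0"
    and low: "\<And>k r z. k < l \<Longrightarrow> r < ?N \<Longrightarrow> coeff (G r z) k = 0"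
    using exists_least_iff[of "\<lambda>k. \<exists>r<?N. \<exists>z. coeff (G r z) k \<noteq> 0"] by blast
  then obtain s B1 c1 where s: "s < ?N" "coeff (G s (B1, c1)) l \<noteq> 0" by auto
  define C where "C r B x = coeff (G r (B, \<lambda>k. esym {..<n} (Suc k) x)) l" for r B x
  have limit: "(\<Sum>r<?N. C r B x * pencil_slope m n B x ^ r) = 0" for B x
  proof -
    obtain R where R: "\<And>t. esym_act m n (?A t B) x n = t * poly R t" "poly R 0 = pencil_slope m n B x"
      using esym_act_pencil_last[OF nm] by blast
    let ?c = "\<lambda>t. esym_act m n (?A t B) x"
    have "\<exists>P. \<forall>t. coeff (G r (B, ?c t)) k = poly P t" if "r < ?N" for r k
    proof (rule poly_funs_line, rule poly_funs_compose_fun_affine[OF poly_family_coeff[OF G[OF that]]])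
      fix k
      have "(\<lambda>t. mat_act n (?A t B) x i) \<in> poly_funs line_affine" for i
        unfolding mat_act_pencil by (intro poly_funs_intros poly_funs_line_id)
      then show "(\<lambda>t. ?c t k) \<in> poly_funs line_affine"
        unfolding esym_act_def by (intro poly_funs_esym) auto
    qed (rule poly_funs.const)
    then have "\<forall>r k. \<exists>P. r < ?N \<longrightarrow> (\<forall>t. coeff (G r (B, ?c t)) k = poly P t)" by blast
    then obtain P where "\<forall>r k. r < ?N \<longrightarrow> (\<forall>t. coeff (G r (B, ?c t)) k = poly (P r k) t)"
      unfolding choice_iff by (elim exE)
    then have P: "\<And>r k t. r < ?N \<Longrightarrow> coeff (G r (B, ?c t)) k = poly (P r k) t" by blast
    have "\<forall>r. \<exists>K. r < ?N \<longrightarrow> (\<forall>z. degree (G r z) \<le> K)"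
      using G unfolding poly_family_def by blast
    then obtain K where "\<forall>r. r < ?N \<longrightarrow> (\<forall>z. degree (G r z) \<le> K r)"
      unfolding choice_iff by (elim exE)
    then have K: "\<And>r z. r < ?N \<Longrightarrow> degree (G r z) \<le> K r" by blast
    \<comment> \<open>The relation along the pencil is \<open>t ^ l\<close> times \<open>V\<close>, so \<open>V\<close> vanishes for all \<open>t\<close>, also at \<open>0\<close>.\<close>
    define V where "V = (\<Sum>r<?N. (\<Sum>i\<le>K r. P r (l + i) * monom 1 i) * R ^ r)"
    have "poly (monom 1 l * V) t = 0" for t
    proof -
      have "poly (monom 1 l * V) t =
          (\<Sum>r<?N. (t ^ l * (\<Sum>i\<le>K r. coeff (G r (B, ?c t)) (l + i) * t ^ i)) * poly R t ^ r)"
        by (simp add: V_def poly_sum poly_monom P sum_distrib_left mult_ac)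
      also have "\<dots> = (\<Sum>r<?N. poly (G r (B, ?c t)) t * poly R t ^ r)"
        by (rule sum.cong) (auto simp: poly_with_low_coeffs_zero[OF K low])
      also have "\<dots> = (\<Sum>r<?N. M r (?A t B, ?c t) * ?c t n ^ r)"
        by (rule sum.cong) (use F(2)[of _ t "(B, ?c t)"] in
          \<open>auto simp: G_def R(1) poly_monom power_mult_distrib mult_ac\<close>)
      also have "\<dots> = 0" by (rule rel)
      finally show ?thesis .
    qed
    then have "monom 1 l * V = 0" using poly_all_0_iff_0 by blast
    then have "poly V 0 = 0" by simp
    moreover have "?c 0 = (\<lambda>k. esym {..<n} (Suc k) x)"
    proof
      fix k
      have "esym {..<m} (Suc k) (mat_act n (?A 0 B) x) = esym {..<n} (Suc k) (mat_act n (?A 0 B) x)"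
        by (rule esym_subset) (use nm in \<open>auto simp: mat_act_pencil[of n 0 B, simplified]\<close>)
      also have "\<dots> = esym {..<n} (Suc k) x"
        by (rule esym_cong) (auto simp: mat_act_pencil[of n 0 B, simplified])
      finally show "?c 0 k = esym {..<n} (Suc k) x" by (simp add: esym_act_def)
    qed
    moreover have "poly V 0 = (\<Sum>r<?N. poly (P r l) 0 * poly R 0 ^ r)"
    proof -
      have "(\<Sum>i\<le>k. poly (P r (l + i)) 0 * 0 ^ i) = poly (P r l) 0" for r k
        by (subst sum.remove[of _ 0]) (auto intro!: sum.neutral)
      then show ?thesis by (simp add: V_def poly_sum poly_monom)
    qed
    ultimately show ?thesis using P[of _ 0 l] R(2) by (simp add: C_def)
  qed
  obtain x1 where x1: "\<forall>k\<in>{1..n}. esym {..<n} k x1 = c1 (k - 1)"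
    using esym_surj[of n "\<lambda>k. c1 (k - 1)"] by blast
  define perms where "perms = {\<sigma>. \<sigma> permutes {..<n}}"
  define I where "I = {(\<sigma>, \<tau>). \<sigma> \<in> perms \<and> \<tau> \<in> perms \<and> \<sigma> \<noteq> \<tau>}"
  define D where "D = (\<lambda>(\<sigma>, \<tau>) (B, x).
    pencil_slope m n B (\<lambda>i. x (\<sigma> i :: nat)) - pencil_slope m n B (\<lambda>i. x (\<tau> i)))"
  have fin: "finite perms" unfolding perms_def by (rule finite_permutations) simp
  have "I \<subseteq> perms \<times> perms" by (auto simp: I_def)
  then have "finite I" using fin finite_subset by blast
  have slope: "(\<lambda>z. pencil_slope m n (fst z) (\<lambda>i. snd z (\<sigma> i))) \<in> poly_funs ?Z" if "\<sigma> \<in> perms" for \<sigma>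
  proof -
    have "\<sigma> i < n" if "i < n" for i using \<open>\<sigma> \<in> perms\<close> that permutes_in_image[of \<sigma> "{..<n}" i]
      by (simp add: perms_def)
    then show ?thesis
      unfolding pencil_slope_def by (intro poly_funs_intros poly_funs_mat_act poly_funs_arg) auto
  qed
  \<comment> \<open>A point where the slopes of all permutations differ and the limit polynomial is not zero; the
    index \<open>None\<close> stands for the second condition.\<close>
  have "\<exists>z\<in>points ?Z. \<forall>i\<in>insert None (Some ` I).
    (case i of None \<Rightarrow> \<lambda>z. C s (fst z) (snd z) | Some p \<Rightarrow> D p) z \<noteq> 0"
  proof (rule finite_nonzero_poly_funs_common_point[OF curve_connected_param_affine])
    fix i assume i: "i \<in> insert None (Some ` I)"
    show "(case i of None \<Rightarrow> \<lambda>z. C s (fst z) (snd z) | Some p \<Rightarrow> D p) \<in> poly_funs ?Z"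
    proof (cases i)
      case None
      have "(\<lambda>z. C s (fst z) (snd z)) \<in> poly_funs ?Z"
        unfolding C_def
        by (rule poly_funs_compose_fun_affine[OF poly_family_coeff[OF G[OF s(1)]]])
          (auto intro!: poly_funs_entry poly_funs_arg poly_funs_esym)
      then show ?thesis using None by simp
    next
      case (Some p)
      then obtain \<sigma> \<tau> where "p = (\<sigma>, \<tau>)" "\<sigma> \<in> perms" "\<tau> \<in> perms" using i by (auto simp: I_def)
      then have "D p \<in> poly_funs ?Z"
        using poly_funs_diff[OF slope slope] by (simp add: D_def case_prod_unfold)
      then show ?thesis using Some by simp
    qed
    show "\<exists>z\<in>points ?Z. (case i of None \<Rightarrow> \<lambda>z. C s (fst z) (snd z) | Some p \<Rightarrow> D p) z \<noteq> 0"
    proof (cases i)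
      case None
      have "coeff (G s (B1, \<lambda>k. esym {..<n} (Suc k) x1)) l = coeff (G s (B1, c1)) l"
        by (rule poly_funs_fun_affine_cong[OF poly_family_coeff[OF G[OF s(1)]]]) (use x1 in auto)
      then have "C s B1 x1 \<noteq> 0" using s(2) by (simp add: C_def)
      then show ?thesis using None by auto
    next
      case (Some p)
      then obtain \<sigma> \<tau> where p: "p = (\<sigma>, \<tau>)" "\<sigma> permutes {..<n}" "\<tau> permutes {..<n}" "\<sigma> \<noteq> \<tau>"
        using i by (auto simp: I_def perms_def)
      obtain B x where "pencil_slope m n B (\<lambda>i. x (\<sigma> i)) \<noteq> pencil_slope m n B (\<lambda>i. x (\<tau> i))"
        using pencil_slope_separates[OF nm p(2-4)] by blast
      then have "D p (B, x) \<noteq> 0" by (simp add: D_def p(1))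
      then show ?thesis using Some by auto
    qed
  qed (use \<open>finite I\<close> in auto)
  then obtain z where z: "\<And>i. i \<in> insert None (Some ` I) \<Longrightarrow>
    (case i of None \<Rightarrow> \<lambda>z. C s (fst z) (snd z) | Some p \<Rightarrow> D p) z \<noteq> 0" by blast
  obtain B x where Bx: "z = (B, x)" by (cases z)
  have Cs: "C s B x \<noteq> 0" using z[of None] by (simp add: Bx)
  have D: "D (\<sigma>, \<tau>) (B, x) \<noteq> 0" if "\<sigma> \<in> perms" "\<tau> \<in> perms" "\<sigma> \<noteq> \<tau>" for \<sigma> \<tau>
    using z[of "Some (\<sigma>, \<tau>)"] that by (auto simp: I_def Bx)
  define P where "P = (\<Sum>r<?N. monom (C r B x) r)"
  have coeff_P: "coeff P r = (if r < ?N then C r B x else 0)" for r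
    unfolding P_def by (simp add: coeff_sum)
  have "P \<noteq> 0" using coeff_P[of s] s(1) Cs by auto
  have "degree P \<le> ?N - 1" by (rule degree_le) (auto simp: coeff_P)
  let ?f = "\<lambda>\<sigma>. pencil_slope m n B (\<lambda>i. x (\<sigma> i))"
  have "inj_on ?f perms"
  proof (rule inj_onI, rule ccontr)
    fix \<sigma> \<tau> assume "\<sigma> \<in> perms" "\<tau> \<in> perms" "?f \<sigma> = ?f \<tau>" "\<sigma> \<noteq> \<tau>"
    then show False using D[of \<sigma> \<tau>] by (simp add: D_def)
  qed
  then have "card (?f ` perms) = ?N" by (simp add: card_image perms_def card_permutations)
  moreover have "?f ` perms \<subseteq> {t. poly P t = 0}"
  proof (rule image_subsetI)
    fix \<sigma> assume "\<sigma> \<in> perms"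
    then have "C r B (\<lambda>i. x (\<sigma> i)) = C r B x" for r by (simp add: C_def perms_def esym_permutes)
    then have "poly P (?f \<sigma>) = 0"
      using limit[of B "\<lambda>i. x (\<sigma> i)"] by (simp add: P_def poly_sum poly_monom)
    then show "?f \<sigma> \<in> {t. poly P t = 0}" by simp
  qed
  ultimately have "?N \<le> card {t. poly P t = 0}"
    using card_mono[OF poly_roots_finite[OF \<open>P \<noteq> 0\<close>]] by metis
  also have "\<dots> \<le> degree P" by (rule card_poly_roots_bound[OF \<open>P \<noteq> 0\<close>])
  also have "\<dots> \<le> ?N - 1" by fact
  finally have "?N \<le> ?N - 1" .
  moreover have "?N > 0" by simp
  ultimately show False by linarith
qed

section \<open>Rational expressions for the coordinates\<close>

lemma bidegree_le_esym_act:
  "(\<lambda>(A, x). esym_act m n A x k) \<in> bidegree_le ({..<m} \<times> {..<n}) {..<n} (Suc k) (Suc k)"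
proof -
  let ?D = "bidegree_le ({..<m} \<times> {..<n}) {..<n}"
  have act: "(\<lambda>z. mat_act n (fst z) (snd z) i) \<in> ?D 1 1" if "i < m" for i
    unfolding mat_act_def
  proof (rule bidegree_le_sum)
    fix j assume "j \<in> {..<n}"
    then show "(\<lambda>z. fst z (i, j) * snd z j) \<in> ?D 1 1"
      using bidegree_le_mult[OF _ _ bidegree_le_fst bidegree_le_snd,
          of "{..<m} \<times> {..<n}" "{..<n}" "(i, j)" j] that by simp
  qed auto
  have "(\<lambda>z. esym I k (mat_act n (fst z) (snd z))) \<in> ?D k k" if "finite I" "I \<subseteq> {..<m}" for I k
    using that
  proof (induction I arbitrary: k rule: finite_induct)
    case empty
    then show ?case by (cases k) (auto simp: esym_empty intro: bidegree_le_const)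
  next
    case (insert i I)
    show ?case
    proof (cases k)
      case 0
      then show ?thesis by (auto intro: bidegree_le_const)
    next
      case (Suc l)
      have "(\<lambda>z. mat_act n (fst z) (snd z) i * esym I l (mat_act n (fst z) (snd z))) \<in> ?D (1 + l) (1 + l)"
        by (rule bidegree_le_mult) (use insert in \<open>auto intro!: act[simplified]\<close>)
      then show ?thesis
        using insert Suc by (auto simp: esym_insert intro!: bidegree_le_add)
    qed
  qed
  then show ?thesis by (simp add: esym_act_def case_prod_unfold)
qed

text \<open>
  Let \<open>e\<close> be the last symmetric function. The space of polynomials of bounded bidegree is too small
  for the products of a monomial in \<open>A\<close>, a monomial in the first \<open>n\<close> symmetric functions, and one
  of the functions \<open>x j\<close> and \<open>e ^ r\<close> with \<open>r < fact n\<close> to be independent in it.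
\<close>

lemma algebraic_relation:
  assumes "j < n"
  obtains M where "\<And>r. M r \<in> poly_funs (param_affine m n)"
    "\<exists>r\<le>fact n. \<exists>A c. M r (A, c) \<noteq> 0"
    "\<And>A x. (\<Sum>r<fact n. M r (A, esym_act m n A x) * esym_act m n A x n ^ r) +
       M (fact n) (A, esym_act m n A x) * x j = 0"
proof -
  let ?V = "{..<m} \<times> {..<n}" and ?N = "fact n :: nat"
  let ?D = "bidegree_le ?V {..<n}" and ?e = "\<lambda>z. esym_act m n (fst z) (snd z)"
  have fV: "finite ?V" and fn: "finite {..<n}" by auto
  \<comment> \<open>A common bound for the degrees of \<open>x j\<close> and of the powers of the last symmetric function.\<close>
  define s where "s = ?N * Suc n"
  obtain d e where de:
    "card (exponents_le ?V (e + (d + s)) \<times> weighted_exponents (\<lambda>_. 1) {..<n} (d + s)) <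
     card (exponents_le ?V e \<times> weighted_exponents Suc {..<n} d \<times> {..?N})"
    by (rule exponent_count[of ?V s n, OF fV])
  define X where "X = exponents_le ?V e"
  define Y where "Y = weighted_exponents Suc {..<n} d"
  define g where "g r z = (if r < ?N then ?e z n ^ r else snd z j)" for r and z :: "(nat \<times> nat \<Rightarrow> complex) \<times> (nat \<Rightarrow> complex)"
  define F where "F = (\<lambda>(\<alpha>, \<beta>, r) z. monomial ?V \<alpha> (fst z) * (monomial {..<n} \<beta> (?e z) * g r z))"
  have fin: "finite X" "finite Y" by (auto simp: X_def Y_def)
  have e: "(\<lambda>z. ?e z k) \<in> ?D (Suc k) (Suc k)" for k
    using bidegree_le_esym_act[of m n k] by (simp add: case_prod_unfold)
  have F: "F i \<in> ?D (e + (d + s)) (d + s)" if i: "i \<in> X \<times> Y \<times> {..?N}" for i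
  proof -
    obtain \<alpha> \<beta> r where abr: "i = (\<alpha>, \<beta>, r)" "\<alpha> \<in> X" "\<beta> \<in> Y" "r \<le> ?N" using i by auto
    have "(\<lambda>z. \<Prod>k<n. ?e z k ^ \<beta> k) \<in> ?D (\<Sum>k<n. \<beta> k * Suc k) (\<Sum>k<n. \<beta> k * Suc k)"
      by (intro bidegree_le_prod[OF fV fn] bidegree_le_power[OF fV fn] e)
    moreover have w: "(\<Sum>k<n. \<beta> k * Suc k) \<le> d"
      using abr(3) unfolding Y_def weighted_exponents_def by (simp add: mult.commute del: mult_Suc mult_Suc_right)
    ultimately have 1: "(\<lambda>z. monomial {..<n} \<beta> (?e z)) \<in> ?D d d"
      unfolding monomial_def by (intro bidegree_le_mono[OF fV fn _ w w])
    have "(\<lambda>z. g r z) \<in> ?D s s"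
    proof (cases "r < ?N")
      case True
      have "(\<lambda>z. ?e z n ^ r) \<in> ?D (r * Suc n) (r * Suc n)" by (intro bidegree_le_power[OF fV fn] e)
      moreover have w: "r * Suc n \<le> s" unfolding s_def using True by (intro mult_right_mono) auto
      ultimately have "(\<lambda>z. ?e z n ^ r) \<in> ?D s s" by (intro bidegree_le_mono[OF fV fn _ w w])
      then show ?thesis using True by (simp add: g_def)
    next
      case False
      have "(\<lambda>z. snd z j) \<in> ?D 0 1" using assms by (intro bidegree_le_snd) auto
      moreover have w: "1 \<le> s" by (simp add: s_def Suc_le_eq)
      ultimately have "(\<lambda>z. snd z j) \<in> ?D s s" by (intro bidegree_le_mono[OF fV fn _ le0 w])
      then show ?thesis using False by (simp add: g_def)
    qed
    then have "(\<lambda>z. monomial ?V \<alpha> (fst z) * (monomial {..<n} \<beta> (?e z) * g r z)) \<in>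
        ?D (e + (d + s)) (0 + (d + s))"
      using abr(2) unfolding X_def
      by (intro bidegree_le_mult[OF fV fn] 1 bidegree_le_monomial_fst[OF fV fn])
    then show ?thesis by (simp add: F_def abr(1))
  qed
  obtain c where c: "\<exists>i\<in>X \<times> Y \<times> {..?N}. c i \<noteq> 0"
    "\<And>z. (\<Sum>i\<in>X \<times> Y \<times> {..?N}. c i * F i z) = 0"
    by (rule linear_dependence[OF _ _ de[folded X_def Y_def] F[unfolded bidegree_le_def]])
      (use fin in auto)
  define M where "M r = (\<lambda>z. \<Sum>\<alpha>\<in>X. (\<Sum>\<beta>\<in>Y. c (\<alpha>, \<beta>, r) * monomial {..<n} \<beta> (snd z)) * monomial ?V \<alpha> (fst z))" for r
  show ?thesis
  proof (rule that)
    show "M r \<in> poly_funs (param_affine m n)" for r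
      unfolding M_def
      by (intro poly_funs_intros poly_funs_fst poly_funs_snd poly_funs_monomial)
  next
    show "\<exists>r\<le>?N. \<exists>A c. M r (A, c) \<noteq> 0"
    proof (rule ccontr)
      assume "\<not> ?thesis"
      then have M0: "M r (A, y) = 0" if "r \<le> ?N" for r A y using that by auto
      obtain \<alpha> \<beta> r where i: "\<alpha> \<in> X" "\<beta> \<in> Y" "r \<le> ?N" "c (\<alpha>, \<beta>, r) \<noteq> 0" using c(1) by auto
      have injX: "inj_on (\<lambda>\<alpha>. restrict \<alpha> ?V) X" by (rule inj_onI) (simp add: X_def exponents_le_def)
      have "restrict \<beta> {..<n} = \<beta>" if "\<beta> \<in> Y" for \<beta>
        using that unfolding Y_def weighted_exponents_def by (blast intro: PiE_restrict)
      then have injY: "inj_on (\<lambda>\<beta>. restrict \<beta> {..<n}) Y" by (intro inj_onI) simp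
      have "(\<Sum>\<beta>\<in>Y. c (\<alpha>, \<beta>, r) * monomial {..<n} \<beta> y) = 0" for y
        using M0[OF i(3), of _ y]
          monomials_independent[OF fV fin(1) injX, where i = \<alpha> and
            c = "\<lambda>\<alpha>. \<Sum>\<beta>\<in>Y. c (\<alpha>, \<beta>, r) * monomial {..<n} \<beta> y"] i(1)
        by (simp add: M_def)
      then have "c (\<alpha>, \<beta>, r) = 0"
        using monomials_independent[OF fn fin(2) injY, where i = \<beta> and c = "\<lambda>\<beta>. c (\<alpha>, \<beta>, r)"] i(2)
        by simp
      then show False using i(4) by simp
    qed
  next
    fix A :: "nat \<times> nat \<Rightarrow> complex" and x :: "nat \<Rightarrow> complex"
    let ?z = "(A, x)"
    have M_g: "(\<Sum>\<alpha>\<in>X. \<Sum>\<beta>\<in>Y. c (\<alpha>, \<beta>, r) * F (\<alpha>, \<beta>, r) ?z) = M r (A, ?e ?z) * g r ?z" for r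
      by (simp add: F_def M_def sum_distrib_left sum_distrib_right mult_ac)
    have "0 = (\<Sum>\<alpha>\<in>X. \<Sum>\<beta>\<in>Y. \<Sum>r\<le>?N. c (\<alpha>, \<beta>, r) * F (\<alpha>, \<beta>, r) ?z)"
      using c(2)[of ?z] by (simp add: sum.cartesian_product case_prod_unfold)
    also have "\<dots> = (\<Sum>\<alpha>\<in>X. \<Sum>r\<le>?N. \<Sum>\<beta>\<in>Y. c (\<alpha>, \<beta>, r) * F (\<alpha>, \<beta>, r) ?z)"
      by (intro sum.cong refl sum.swap)
    also have "\<dots> = (\<Sum>r\<le>?N. \<Sum>\<alpha>\<in>X. \<Sum>\<beta>\<in>Y. c (\<alpha>, \<beta>, r) * F (\<alpha>, \<beta>, r) ?z)"
      by (rule sum.swap)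
    also have "\<dots> = (\<Sum>r\<le>?N. M r (A, ?e ?z) * g r ?z)" by (simp only: M_g)
    also have "\<dots> = (\<Sum>r<?N. M r (A, ?e ?z) * ?e ?z n ^ r) + M ?N (A, ?e ?z) * x j"
      by (simp add: lessThan_Suc_atMost[symmetric] g_def)
    finally show "(\<Sum>r<?N. M r (A, esym_act m n A x) * esym_act m n A x n ^ r) +
       M ?N (A, esym_act m n A x) * x j = 0" by simp
  qed
qed

text \<open>
  If the coefficient of \<open>x j\<close> in the relation vanished on the image, then independence of the
  powers, applied to this coefficient as a constant term and to the rest of the relation, would
  make all coefficients zero.
\<close>

lemma coordinate_is_fraction:
  assumes "n < m" "j < n"
  obtains a b where "a \<in> poly_funs (param_affine m n)"
    "b \<in> poly_funs (fun_affine ({..<m} \<times> {..<n}) \<times>\<^sub>A fun_affine {..<Suc n})"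
    "\<And>A x. a (A, esym_act m n A x) * x j = b (A, esym_act m n A x)"
    "\<exists>A x. a (A, esym_act m n A x) \<noteq> 0"
proof -
  let ?N = "fact n :: nat" and ?T = "fun_affine ({..<m} \<times> {..<n}) \<times>\<^sub>A fun_affine {..<Suc n}"
  obtain M where M: "\<And>r. M r \<in> poly_funs (param_affine m n)" "\<exists>r\<le>?N. \<exists>A c. M r (A, c) \<noteq> 0"
    "\<And>A x. (\<Sum>r<?N. M r (A, esym_act m n A x) * esym_act m n A x n ^ r) +
       M ?N (A, esym_act m n A x) * x j = 0"
    using algebraic_relation[OF assms(2)] by blast
  define b where "b z = - (\<Sum>r<?N. M r z * snd z n ^ r)" for z
  show ?thesis
  proof (rule that)
    show "M ?N \<in> poly_funs (param_affine m n)" by (rule M)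
  next
    have "(\<lambda>z. M r (fst z, snd z)) \<in> poly_funs ?T" for r
      by (rule poly_funs_compose_fun_affine[OF M(1)])
        (auto intro!: poly_funs_fst[OF fun_affine_coord] poly_funs_snd[OF fun_affine_coord])
    then have "M r \<in> poly_funs ?T" for r by simp
    moreover have "(\<lambda>z. snd z n) \<in> poly_funs ?T" by (rule poly_funs_snd, rule fun_affine_coord) simp
    ultimately have "(\<lambda>z. - (\<Sum>r<?N. M r z * snd z n ^ r)) \<in> poly_funs ?T"
      by (intro poly_funs_intros) auto
    then show "b \<in> poly_funs ?T" by (simp add: b_def[abs_def])
  next
    fix A x show "M ?N (A, esym_act m n A x) * x j = b (A, esym_act m n A x)"
      using M(3)[of A x] by (simp add: b_def eq_neg_iff_add_eq_0 add.commute)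
  next
    show "\<exists>A x. M ?N (A, esym_act m n A x) \<noteq> 0"
    proof (rule ccontr)
      assume "\<not> ?thesis"
      then have z: "M ?N (A, esym_act m n A x) = 0" for A x by blast
      have "M ?N (A, c) = 0" for A c
      proof -
        let ?M = "\<lambda>r::nat. if r = 0 then M ?N else (\<lambda>_. 0)"
        have "?M 0 (A, c) = 0"
        proof (rule esym_powers_independent[where M = ?M, OF assms(1)])
          show "?M r \<in> poly_funs (param_affine m n)" for r using M(1) by (auto intro: poly_funs.const)
          fix A x
          show "(\<Sum>r<?N. ?M r (A, esym_act m n A x) * esym_act m n A x n ^ r) = 0"
            by (rule sum.neutral) (auto simp: z)
        qed simp
        then show ?thesis by simp
      qed
      moreover have "M r (A, c) = 0" if "r < ?N" for r A c
      proof (rule esym_powers_independent[OF assms(1) M(1) _ that])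
        fix A x
        show "(\<Sum>r<?N. M r (A, esym_act m n A x) * esym_act m n A x n ^ r) = 0"
          using M(3)[of A x] z by simp
      qed
      ultimately show False using M(2) le_neq_implies_less by metis
    qed
  qed
qed

section \<open>The power sum map\<close>

lemma mat_act_cong:
  assumes "\<And>j. j < n \<Longrightarrow> A (i, j) = A' (i, j)" "\<And>j. j < n \<Longrightarrow> x j = x' j"
  shows "mat_act n A x i = mat_act n A' x' i"
  unfolding mat_act_def using assms by (intro sum.cong) auto

lemma power_sum_mat_act:
  assumes "A \<in> carrier_mat m n" "x \<in> carrier_vec n"
  shows "power_sum k (A *\<^sub>v x) = (\<Sum>i<m. mat_act n (\<lambda>ij. A $$ ij) (\<lambda>j. x $ j) i ^ k)"
proof -
  have "(A *\<^sub>v x) $ i = mat_act n (\<lambda>ij. A $$ ij) (\<lambda>j. x $ j) i" if "i < m" for i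
    using assms that by (auto simp: mat_act_def scalar_prod_def atLeast0LessThan intro!: sum.cong)
  then show ?thesis using assms by (auto simp: power_sum_def intro!: sum.cong)
qed

theorem theorem1:
  fixes m n :: nat
  assumes "m > n" and "n > 0"
  shows "birational_onto_image
           (mat_affine m n \<times>\<^sub>A vec_affine n)
           (points (mat_affine m n \<times>\<^sub>A vec_affine n))
           (mat_affine m n \<times>\<^sub>A vec_affine (n + 1))
           (power_sum_map n)"
proof -
  let ?S = "mat_affine m n \<times>\<^sub>A vec_affine n" and ?T = "mat_affine m n \<times>\<^sub>A vec_affine (n + 1)"
  let ?h = "power_sum_map n"
  let ?mat = "\<lambda>A ij. A $$ ij" and ?vec = "\<lambda>x j. x $ j"
  have "\<forall>j. \<exists>a b. j < n \<longrightarrow> a \<in> poly_funs (param_affine m n) \<and>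
      b \<in> poly_funs (fun_affine ({..<m} \<times> {..<n}) \<times>\<^sub>A fun_affine {..<Suc n}) \<and>
      (\<forall>A x. a (A, esym_act m n A x) * x j = b (A, esym_act m n A x)) \<and>
      (\<exists>A x. a (A, esym_act m n A x) \<noteq> 0)"
    using coordinate_is_fraction[OF assms(1)] by metis
  then obtain a b where *: "\<forall>j. j < n \<longrightarrow> a j \<in> poly_funs (param_affine m n) \<and>
      b j \<in> poly_funs (fun_affine ({..<m} \<times> {..<n}) \<times>\<^sub>A fun_affine {..<Suc n}) \<and>
      (\<forall>A x. a j (A, esym_act m n A x) * x j = b j (A, esym_act m n A x)) \<and>
      (\<exists>A x. a j (A, esym_act m n A x) \<noteq> 0)"
    unfolding choice_iff by (elim exE)
  have a: "\<And>j. j < n \<Longrightarrow> a j \<in> poly_funs (param_affine m n)"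
    and b: "\<And>j. j < n \<Longrightarrow> b j \<in> poly_funs (fun_affine ({..<m} \<times> {..<n}) \<times>\<^sub>A fun_affine {..<Suc n})"
    and ab: "\<And>j A x. j < n \<Longrightarrow> a j (A, esym_act m n A x) * x j = b j (A, esym_act m n A x)"
    and nz: "\<And>j. j < n \<Longrightarrow> \<exists>A x. a j (A, esym_act m n A x) \<noteq> 0"
    using * by blast+
  define E where "E y k = esym_of_power_sums (Suc k) (?vec (snd y))"
    for y :: "complex mat \<times> complex vec" and k
  define Q where "Q j y = a j (?mat (fst y), E y)" for j y
  define P where "P j y = b j (?mat (fst y), E y)" for j y
  have entry: "(\<lambda>y. fst y $$ (i, j)) \<in> poly_funs ?T" if "i < m" "j < n" for i j
    by (rule poly_funs_fst, rule poly_funs.coord) (use that in \<open>auto simp: mat_affine_def\<close>)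
  have arg: "(\<lambda>y. snd y $ k) \<in> poly_funs ?T" if "k < n + 1" for k
    by (rule poly_funs_snd, rule poly_funs.coord) (use that in \<open>auto simp: vec_affine_def\<close>)
  have E: "(\<lambda>y. E y k) \<in> poly_funs ?T" if "k < Suc n" for k
    unfolding E_def using that by (intro poly_funs_esym_of_power_sums arg) auto
  have Q: "Q j \<in> poly_funs ?T" if "j < n" for j
    using poly_funs_compose_fun_affine[OF a[OF that], of "\<lambda>y. ?mat (fst y)" ?T E] entry E
    by (auto simp: Q_def[abs_def])
  have P: "P j \<in> poly_funs ?T" if "j < n" for j
    using poly_funs_compose_fun_affine[OF b[OF that], of "\<lambda>y. ?mat (fst y)" ?T E] entry E
    by (auto simp: P_def[abs_def])
  have E_h: "E (?h (A, x)) k = esym_act m n (?mat A) (?vec x) k"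
    if "A \<in> carrier_mat m n" "x \<in> carrier_vec n" "k < Suc n" for A x k
    unfolding E_def esym_act_def
    by (rule esym_of_power_sums)
      (use that power_sum_mat_act[OF that(1,2)] in \<open>auto simp: power_sum_map_def\<close>)
  \<comment> \<open>The entries of \<open>E (?h (A, x))\<close> from \<open>n + 1\<close> on are meaningless, since they read power sums beyond
    the end of the vector. The polynomials \<open>a j\<close> and \<open>b j\<close> do not depend on them.\<close>
  have Q_h: "Q j (?h (A, x)) = a j (?mat A, esym_act m n (?mat A) (?vec x))"
    if "A \<in> carrier_mat m n" "x \<in> carrier_vec n" "j < n" for A x j
    unfolding Q_def
    by (rule poly_funs_fun_affine_cong[OF a[OF that(3)]])
      (use E_h[OF that(1,2)] in \<open>auto simp: power_sum_map_def\<close>)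
  have P_h: "P j (?h (A, x)) = b j (?mat A, esym_act m n (?mat A) (?vec x))"
    if "A \<in> carrier_mat m n" "x \<in> carrier_vec n" "j < n" for A x j
    unfolding P_def
    by (rule poly_funs_fun_affine_cong[OF b[OF that(3)]])
      (use E_h[OF that(1,2)] in \<open>auto simp: power_sum_map_def\<close>)
  \<comment> \<open>The left inverse; the product of all \<open>Q j\<close> serves as common denominator.\<close>
  define g where "g y = (fst y, vec n (\<lambda>j. P j y / Q j y))" for y
  show ?thesis
  proof (rule birational_onto_imageI[where Q = "\<lambda>y. \<Prod>j<n. Q j y" and g = g])
    show "curve_connected ?S"
      by (intro curve_connected_prod curve_connected_mat_affine curve_connected_vec_affine)
    show "?h ` points ?S \<subseteq> points ?T"
      by (auto simp: power_sum_map_def mat_affine_def vec_affine_def)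
    show "(\<lambda>y. \<Prod>j<n. Q j y) \<in> poly_funs ?T" by (intro poly_funs_prod Q) auto
  next
    fix c assume "c \<in> coords ?T"
    then consider i j where "i < m" "j < n" "c = (\<lambda>y. fst y $$ (i, j))"
      | k where "k < n + 1" "c = (\<lambda>y. snd y $ k)"
      by (auto simp: prod_affine_def mat_affine_def vec_affine_def comp_def)
    then show "\<exists>q\<in>poly_funs ?S. \<forall>x\<in>points ?S. c (?h x) = q x"
    proof cases
      case 1
      have "(\<lambda>y. fst y $$ (i, j)) \<in> poly_funs ?S"
        by (rule poly_funs_fst, rule poly_funs.coord) (use 1 in \<open>auto simp: mat_affine_def\<close>)
      then show ?thesis using 1 by (intro bexI) (auto simp: power_sum_map_def)
    next
      case 2
      have "(\<lambda>z. fst z $$ (i, j)) \<in> poly_funs ?S" if "i < m" "j < n" for i j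
        by (rule poly_funs_fst, rule poly_funs.coord) (use that in \<open>auto simp: mat_affine_def\<close>)
      moreover have "(\<lambda>z. snd z $ j) \<in> poly_funs ?S" if "j < n" for j
        by (rule poly_funs_snd, rule poly_funs.coord) (use that in \<open>auto simp: vec_affine_def\<close>)
      ultimately have "(\<lambda>z. \<Sum>i<m. mat_act n (?mat (fst z)) (?vec (snd z)) i ^ Suc k) \<in> poly_funs ?S"
        unfolding mat_act_def by (intro poly_funs_intros) auto
      then show ?thesis
        using 2 by (intro bexI)
          (auto simp: power_sum_map_def mat_affine_def vec_affine_def power_sum_mat_act)
    qed
  next
    fix y y' assume y: "y \<in> points ?T" "y' \<in> points ?T" and c: "\<And>c. c \<in> coords ?T \<Longrightarrow> c y = c y'"
    have "fst y $$ (i, j) = fst y' $$ (i, j)" if "i < m" "j < n" for i j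
      using c[of "\<lambda>y. fst y $$ (i, j)"] that
      by (force simp: prod_affine_def mat_affine_def vec_affine_def comp_def)
    moreover have "snd y $ k = snd y' $ k" if "k < n + 1" for k
      using c[of "\<lambda>y. snd y $ k"] that
      by (force simp: prod_affine_def mat_affine_def vec_affine_def comp_def)
    ultimately show "y = y'"
      using y by (auto simp: prod_eq_iff mat_affine_def vec_affine_def intro!: eq_matI eq_vecI)
  next
    have "\<exists>z\<in>points (param_affine m n). \<forall>j\<in>{..<n}. a j (fst z, esym_act m n (fst z) (snd z)) \<noteq> 0"
    proof (rule finite_nonzero_poly_funs_common_point[OF curve_connected_param_affine])
      fix j assume "j \<in> {..<n}"
      then have j: "j < n" by simp
      show "(\<lambda>z. a j (fst z, esym_act m n (fst z) (snd z))) \<in> poly_funs (param_affine m n)"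
        by (rule poly_funs_compose_fun_affine[OF a[OF j]])
          (auto simp: esym_act_def intro!: poly_funs_entry poly_funs_esym poly_funs_mat_act poly_funs_arg)
      show "\<exists>z\<in>points (param_affine m n). a j (fst z, esym_act m n (fst z) (snd z)) \<noteq> 0"
        using nz[OF j] by auto
    qed auto
    then obtain A x where Ax: "\<And>j. j < n \<Longrightarrow> a j (A, esym_act m n A x) \<noteq> 0" by auto
    let ?A = "mat m n A" and ?x = "vec n x"
    have act: "esym_act m n (?mat ?A) (?vec ?x) k = esym_act m n A x k" for k
      unfolding esym_act_def by (intro esym_cong mat_act_cong) auto
    have "a j (?mat ?A, esym_act m n (?mat ?A) (?vec ?x)) = a j (A, esym_act m n A x)" if "j < n" for j
      by (rule poly_funs_fun_affine_cong[OF a[OF that]]) (auto simp: act)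
    then have "(\<Prod>j<n. Q j (?h (?A, ?x))) \<noteq> 0" using Ax by (simp add: Q_h)
    then show "\<exists>x\<in>points ?S. (\<Prod>j<n. Q j (?h x)) \<noteq> 0"
      by (intro bexI[of _ "(?A, ?x)"]) (auto simp: mat_affine_def vec_affine_def)
  next
    show "g y \<in> points ?S" if "y \<in> points ?T" for y
      using that by (auto simp: g_def mat_affine_def vec_affine_def)
  next
    fix c assume "c \<in> coords ?S"
    then consider i j where "i < m" "j < n" "c = (\<lambda>y. fst y $$ (i, j))"
      | j where "j < n" "c = (\<lambda>y. snd y $ j)"
      by (auto simp: prod_affine_def mat_affine_def vec_affine_def comp_def)
    then show "\<exists>R\<in>poly_funs ?T. \<forall>y\<in>points ?T. (\<Prod>j<n. Q j y) \<noteq> 0 \<longrightarrow> c (g y) * (\<Prod>j<n. Q j y) = R y"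
    proof cases
      case 1
      have "(\<lambda>y. fst y $$ (i, j) * (\<Prod>j<n. Q j y)) \<in> poly_funs ?T"
        by (intro poly_funs_intros entry Q 1) auto
      then show ?thesis using 1 by (intro bexI) (auto simp: g_def)
    next
      case 2
      have "(\<lambda>y. P j y * (\<Prod>i\<in>{..<n} - {j}. Q i y)) \<in> poly_funs ?T"
        by (intro poly_funs_intros P Q 2) auto
      moreover have "c (g y) * (\<Prod>j<n. Q j y) = P j y * (\<Prod>i\<in>{..<n} - {j}. Q i y)"
        if "(\<Prod>j<n. Q j y) \<noteq> 0" for y
        using 2 that by (subst prod.remove[of _ j]) (auto simp: g_def)
      ultimately show ?thesis by (intro bexI) auto
    qed
  next
    fix z assume z: "z \<in> points ?S" "(\<Prod>j<n. Q j (?h z)) \<noteq> 0"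
    obtain A x where Ax: "z = (A, x)" "A \<in> carrier_mat m n" "x \<in> carrier_vec n"
      using z(1) by (cases z) (auto simp: mat_affine_def vec_affine_def)
    have "P j (?h z) / Q j (?h z) = x $ j" if "j < n" for j
    proof -
      have "Q j (?h z) \<noteq> 0" using z(2) that by auto
      moreover have "Q j (?h z) * x $ j = P j (?h z)"
        unfolding Ax(1) Q_h[OF Ax(2,3) that] P_h[OF Ax(2,3) that] using ab[OF that] .
      ultimately show ?thesis by (simp add: field_simps)
    qed
    then have "vec n (\<lambda>j. P j (?h z) / Q j (?h z)) = x" using Ax(3) by (intro eq_vecI) auto
    then show "g (?h z) = z" by (simp add: g_def Ax(1) power_sum_map_def)
  qed
qed

end
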